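(* Let $\kappa,e_1,\dots,e_9\in\mathbb{C}^\times$ with $e_i$ pairwise distinct and $\kappa^3\prod_{i=1}^9e_i=1$, and let $A(x)=I+A^{(1)}x+A^{(2)}x^2+\kappa Ix^3$ be a $3\times3$ matrix polynomial with $\det A(x)=\kappa^3\prod_{i=1}^9(x+e_i)$. Define constant $3\times3$ matrices $A_1,A_2,A_3$ by $$\sum_{i=1}^3\frac{A_i}{x+e_i}=\frac{I-A'(x)}{(1-q)x},\qquad A'(x)=\frac{A(x)}{(1+x/e_1)(1+x/e_2)(1+x/e_3)}.$$ Assume $\kappa e_1e_2e_3\neq1$ and $\mathrm{Ker}A_1\cap\mathrm{Ker}A_2\cap\mathrm{Ker}A_3=\{0\}$. Put $q^\lambda=(\kappa e_1e_2e_3)^{-1}$ and apply the $q$-middle convolution $mc_\lambda$ to $(A_1,A_2,A_3)$ with points $(t_1,t_2,t_3)=(-e_1,-e_2,-e_3)$. Then the quotient space $\mathbb{C}^9/(\mathcal K+\mathcal L)$ is $3$-dimensional, and, writing $\bar G_1,\bar G_2,\bar G_3$ for the induced $3\times3$ matrices in any basis, the matrix $$\tilde A(x)=(1+x/e_1)(1+x/e_2)(1+x/e_3)\Big[I-(1-q)x\sum_{i=1}^3\frac{\bar G_i}{x+e_i}\Big]$$ is a polynomial of the form $\tilde A(x)=I+\tilde A^{(1)}x+\tilde A^{(2)}x^2+\tilde\kappa Ix^3$ with $\det\tilde A(x)=\tilde\kappa^3\prod_{i=1}^9(x+\tilde e_i)$, where $\tilde e_i=e_i$ for $i=1,2,3$,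 $\tilde e_i=\kappa e_1e_2e_3e_i$ for $i=4,\dots,9$, and $\tilde\kappa=\frac{1}{\kappa(e_1e_2e_3)^2}$.
   Context: Fix $q$ with $0<|q|<1$, $[\lambda]=\frac{1-q^\lambda}{1-q}$ (only the value $q^\lambda$ matters). The system $T_xy=A(x)y$, after the gauge transformation by $g=(-x/e_1)_\infty(-x/e_2)_\infty(-x/e_3)_\infty$, becomes $T_xy=A'y$, equivalently $D_xy=\sum_i\frac{A_i}{x+e_i}y$; the matrix $\tilde A$ corresponds to applying $mc_\lambda$ and then the gauge transformation by $g^{-1}$. $q$-middle convolution: given constant $M\times M$ matrices $B_1,\dots,B_N$ (attached to the system $D_xy=\sum_i\frac{B_i}{x-t_i}y$) and $\lambda$, let $G_i$ ($MN\times MN$) have $i$-th block row $[q^\lambda B_1,\dots,q^\lambda B_{i-1},q^\lambda B_i+[\lambda]I_M,q^\lambda B_{i+1},\dots,q^\lambda B_N]$ and zero other block rows. Let $\mathcal K=\mathrm{Ker}B_1\oplus\cdots\oplus\mathrm{Ker}B_N\subset\mathbb{C}^{MN}$ and $\mathcal L=\mathrm{Ker}(G_1+\cdots+G_N)$; both are invariant under every $G_i$. $mc_\lambda(B_1,\dots,B_N)=(\bar G_1,\dots,\bar G_N)$, where $\bar G_i$ is the endomorphism induced by $G_i$ on $\mathbb{C}^{MN}/(\mathcal K+\mathcal L)$. *)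

theory Defs
  imports "Jordan_Normal_Form.Determinant"
begin

(* q-middle convolution data. Block indices and matrix indices are 0-based:
   B :: nat => complex mat, B j (j < N) is an M x M matrix (the paper's B_{j+1}).
   ql stands for the value q^lambda, lb for [lambda] = (1 - q^lambda)/(1 - q). *)

definition qmc_G :: "nat \<Rightarrow> nat \<Rightarrow> (nat \<Rightarrow> complex mat) \<Rightarrow> complex \<Rightarrow> complex \<Rightarrow> nat \<Rightarrow> complex mat" where
  "qmc_G M N B ql lb i = mat (M*N) (M*N)
     (\<lambda>(r,c). if r div M = i
              then ql * (B (c div M) $$ (r mod M, c mod M)) + (if r = c then lb else 0)
              else 0)"

definition qmc_Gsum :: "nat \<Rightarrow> nat \<Rightarrow> (nat \<Rightarrow> complex mat) \<Rightarrow> complex \<Rightarrow> complex \<Rightarrow> complex mat" where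
  "qmc_Gsum M N B ql lb = foldr (\<lambda>i acc. qmc_G M N B ql lb i + acc) [0..<N] (0\<^sub>m (M*N) (M*N))"

definition blk :: "nat \<Rightarrow> nat \<Rightarrow> complex vec \<Rightarrow> complex vec" where
  "blk M j v = vec M (\<lambda>a. v $ (j*M + a))"

definition qmc_K :: "nat \<Rightarrow> nat \<Rightarrow> (nat \<Rightarrow> complex mat) \<Rightarrow> complex vec set" where
  "qmc_K M N B = {v \<in> carrier_vec (M*N). \<forall>j<N. B j *\<^sub>v blk M j v = 0\<^sub>v M}"

definition qmc_L :: "nat \<Rightarrow> nat \<Rightarrow> (nat \<Rightarrow> complex mat) \<Rightarrow> complex \<Rightarrow> complex \<Rightarrow> complex vec set" where
  "qmc_L M N B ql lb = {v \<in> carrier_vec (M*N). qmc_Gsum M N B ql lb *\<^sub>v v = 0\<^sub>v (M*N)}"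

definition qmc_W :: "nat \<Rightarrow> nat \<Rightarrow> (nat \<Rightarrow> complex mat) \<Rightarrow> complex \<Rightarrow> complex \<Rightarrow> complex vec set" where
  "qmc_W M N B ql lb = {k + l | k l. k \<in> qmc_K M N B \<and> l \<in> qmc_L M N B ql lb}"

definition lincomb :: "nat \<Rightarrow> nat \<Rightarrow> (nat \<Rightarrow> complex) \<Rightarrow> (nat \<Rightarrow> complex vec) \<Rightarrow> complex vec" where
  "lincomb n d c v = vec n (\<lambda>r. \<Sum>k<d. c k * (v k $ r))"

definition quot_basis :: "nat \<Rightarrow> complex vec set \<Rightarrow> nat \<Rightarrow> (nat \<Rightarrow> complex vec) \<Rightarrow> bool" where
  "quot_basis n W d v \<longleftrightarrow>
     (\<forall>k<d. v k \<in> carrier_vec n) \<and>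
     (\<forall>c. lincomb n d c v \<in> W \<longrightarrow> (\<forall>k<d. c k = 0)) \<and>
     (\<forall>u \<in> carrier_vec n. \<exists>c. u - lincomb n d c v \<in> W)"

definition induced_mat :: "nat \<Rightarrow> complex vec set \<Rightarrow> nat \<Rightarrow> (nat \<Rightarrow> complex vec) \<Rightarrow> complex mat \<Rightarrow> complex mat \<Rightarrow> bool" where
  "induced_mat n W d v G Gb \<longleftrightarrow>
     Gb \<in> carrier_mat d d \<and>
     (\<forall>j<d. G *\<^sub>v v j - lincomb n d (\<lambda>k. Gb $$ (k, j)) v \<in> W)"

end

theory Submission
  imports Defs
begin

text \<open>
  Put \<open>s = \<kappa> e\<^sub>1 e\<^sub>2 e\<^sub>3\<close>, so \<open>q\<^sup>\<lambda> = 1/s\<close>. Comparing leading coefficients, \<open>A\<^sub>1 + A\<^sub>2 + A\<^sub>3\<close> is the scalar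
  \<open>(1 - s)/(1 - q)\<close>, which makes \<open>\<L>\<close> the diagonal copy of \<open>\<complex>\<^sup>3\<close>; each \<open>Ker A\<^sub>i\<close> is a line because \<open>- e\<^sub>i\<close> is
  a simple zero of \<open>det A\<close>. Hence \<open>\<K> + \<L>\<close> has dimension 6.
  The operator \<open>I - (1 - q) x \<Sum> G\<^sub>i / (x + e\<^sub>i)\<close> acts on \<open>Ker A\<^sub>i\<close> by \<open>f\<^sub>i = (x/s + e\<^sub>i)/(x + e\<^sub>i)\<close> and trivially on
  \<open>\<L>\<close>, while the matrix determinant lemma evaluates its determinant on \<open>\<complex>\<^sup>9\<close> as
  \<open>(f\<^sub>1 f\<^sub>2 f\<^sub>3)\<^sup>3 det A'(x/s)\<close>; the determinant on the quotient is therefore \<open>(f\<^sub>1 f\<^sub>2 f\<^sub>3)\<^sup>2 det A'(x/s)\<close>.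
  The sum of the \<open>G\<^sub>i\<close> is the scalar \<open>[\<lambda>]\<close> modulo \<open>\<L>\<close>, which gives the leading coefficient.
\<close>

section \<open>Independent families, their spans and bases of a quotient of
  \<open>C^n\<close>\<close>

text \<open>Families are functions on the naturals of which only the first \<open>d\<close> values
  count. This is the convention of \<open>quot_basis\<close>, so that \<open>lincomb\<close> serves
  for bases of the subspace and of the quotient alike.\<close>

definition indep_family :: "nat \<Rightarrow> nat \<Rightarrow> (nat \<Rightarrow> complex vec) \<Rightarrow> bool" where
  "indep_family n d w \<longleftrightarrow> (\<forall>k<d. w k \<in> carrier_vec n) \<and>
     (\<forall>c. lincomb n d c w = 0\<^sub>v n \<longrightarrow> (\<forall>k<d. c k = 0))"

definition family_span :: "nat \<Rightarrow> nat \<Rightarrow> (nat \<Rightarrow> complex vec) \<Rightarrow> complex vec set" where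
  "family_span n d w = range (\<lambda>c. lincomb n d c w)"

definition colmat :: "nat \<Rightarrow> nat \<Rightarrow> (nat \<Rightarrow> complex vec) \<Rightarrow> complex mat" where
  "colmat n d w = mat n d (\<lambda>(r,k). w k $ r)"

definition append_family :: "nat \<Rightarrow> (nat \<Rightarrow> complex vec) \<Rightarrow> (nat \<Rightarrow> complex vec) \<Rightarrow> nat \<Rightarrow> complex vec" where
  "append_family m w v k = (if k < m then w k else v (k - m))"

lemma sum_lessThan_add: "(\<Sum>k<m + d. f k) = (\<Sum>k<m. f k) + (\<Sum>k<d. f (m + k))"
  for f :: "nat \<Rightarrow> 'a::comm_monoid_add"
  by (induction d) (simp_all add: add.assoc)

lemma det_mat_diag: "det (mat_diag n f) = (\<Prod>k<n. f k)" for f :: "nat \<Rightarrow> 'a::comm_ring_1"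
  by (subst det_upper_triangular[of _ n])
     (auto simp: mat_diag_def diag_mat_def prod.list_conv_set_nth lessThan_atLeast0)

lemma colmat_carrier [simp]: "colmat n d w \<in> carrier_mat n d"
  by (simp add: colmat_def)

lemma lincomb_carrier [simp]: "lincomb n d c w \<in> carrier_vec n"
  by (simp add: lincomb_def)

lemma lincomb_index [simp]: "r < n \<Longrightarrow> lincomb n d c w $ r = (\<Sum>k<d. c k * w k $ r)"
  by (simp add: lincomb_def)

lemma lincomb_cong: "(\<And>k. k < d \<Longrightarrow> c k = c' k) \<Longrightarrow> (\<And>k. k < d \<Longrightarrow> w k = w' k) \<Longrightarrow>
    lincomb n d c w = lincomb n d c' w'"
  by (simp add: lincomb_def)

lemma dim_lincomb [simp]: "dim_vec (lincomb n d c w) = n"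
  by (simp add: lincomb_def)

lemma colmat_mult_vec:
  assumes "x \<in> carrier_vec d"
  shows "colmat n d w *\<^sub>v x = lincomb n d (\<lambda>k. x $ k) w"
  using assms
  by (intro eq_vecI)
     (auto simp: colmat_def scalar_prod_def lessThan_atLeast0 mult.commute intro!: sum.cong)

lemma col_colmat: "k < d \<Longrightarrow> w k \<in> carrier_vec n \<Longrightarrow> col (colmat n d w) k = w k"
  by (auto simp: colmat_def)

lemma indep_family_det:
  assumes "indep_family n n w"
  shows "det (colmat n n w) \<noteq> 0"
proof
  assume "det (colmat n n w) = 0"
  then obtain v where v: "v \<in> carrier_vec n" "v \<noteq> 0\<^sub>v n" "colmat n n w *\<^sub>v v = 0\<^sub>v n"
    using det_0_iff_vec_prod_zero[OF colmat_carrier] by blast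
  then have "\<forall>k<n. v $ k = 0"
    using assms by (auto simp: indep_family_def colmat_mult_vec)
  then show False using v(1,2) by (auto intro: eq_vecI)
qed

text \<open>The column matrix of the family is invertible, and its inverse applied to
  \<open>u\<close> supplies the coefficients.\<close>

lemma indep_family_spans:
  assumes "indep_family n n w" and u: "u \<in> carrier_vec n"
  shows "u \<in> family_span n n w"
proof -
  have "det (colmat n n w) \<noteq> 0" by (rule indep_family_det[OF assms(1)])
  then have "colmat n n w \<in> Units (ring_mat TYPE(complex) n n)"
    by (intro det_non_zero_imp_unit) auto
  then obtain Q where Q: "Q \<in> carrier_mat n n" "colmat n n w * Q = 1\<^sub>m n"
    by (auto simp: Units_def ring_mat_def)
  have "u = colmat n n w *\<^sub>v (Q *\<^sub>v u)"
    using Q u by (simp add: assoc_mult_mat_vec[symmetric, OF colmat_carrier])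
  also have "\<dots> = lincomb n n (\<lambda>k. (Q *\<^sub>v u) $ k) w"
    using Q u by (intro colmat_mult_vec) auto
  finally show ?thesis unfolding family_span_def by blast
qed

text \<open>Since \<open>d < n\<close>, filling up the family with zero columns gives a singular
  square matrix \<open>Q\<close>. A nonzero kernel vector \<open>y\<close> of its transpose pairs to
  zero with every \<open>w k\<close>, so any unit vector at a position where \<open>y\<close> does
  not vanish lies outside the span.\<close>

lemma indep_family_extend_one:
  assumes w: "indep_family n d w" and "d < n"
  shows "\<exists>u. indep_family n (Suc d) (w(d := u))"
proof -
  define Q where "Q = colmat n n (\<lambda>k. if k < d then w k else 0\<^sub>v n)"
  have Qc: "Q \<in> carrier_mat n n" by (simp add: Q_def)
  have "Q *\<^sub>v unit_vec n d = 0\<^sub>v n"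
    unfolding Q_def colmat_mult_vec[OF unit_vec_carrier]
    using \<open>d < n\<close> by (intro eq_vecI) (auto simp: unit_vec_def intro!: sum.neutral)
  moreover have "unit_vec n d \<noteq> (0\<^sub>v n :: complex vec)"
    using \<open>d < n\<close> by simp
  ultimately have "det Q = 0"
    using det_0_iff_vec_prod_zero[OF Qc] unit_vec_carrier by blast
  then have "det (transpose_mat Q) = 0" using det_transpose[OF Qc] by simp
  then obtain y where y: "y \<in> carrier_vec n" "y \<noteq> 0\<^sub>v n" "transpose_mat Q *\<^sub>v y = 0\<^sub>v n"
    using det_0_iff_vec_prod_zero[of "transpose_mat Q" n] Qc by auto
  have orth: "(\<Sum>r<n. w k $ r * y $ r) = 0" if "k < d" for k
  proof -
    have "(transpose_mat Q *\<^sub>v y) $ k = 0" using y(3) that \<open>d < n\<close> by simp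
    then show ?thesis
      using that \<open>d < n\<close> y(1) Qc by (auto simp: Q_def colmat_def scalar_prod_def lessThan_atLeast0)
  qed
  obtain p where p: "p < n" "y $ p \<noteq> 0" using y(1,2) by (metis carrier_vecD eq_vecI index_zero_vec)
  have "c k = 0" if c: "lincomb n (Suc d) c (w(d := unit_vec n p)) = 0\<^sub>v n" and k: "k < Suc d" for c k
  proof -
    have e: "(\<Sum>l<d. c l * w l $ r) + c d * (if r = p then 1 else 0) = 0" if "r < n" for r
    proof -
      have "lincomb n (Suc d) c (w(d := unit_vec n p)) $ r = 0" using c that by simp
      then show ?thesis using that p by (simp add: unit_vec_def)
    qed
    \<comment> \<open>Pairing the relation with \<open>y\<close> removes the contribution of
      \<open>w\<close> and leaves \<open>c d * y $ p\<close>.\<close>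
    have "0 = (\<Sum>r<n. ((\<Sum>l<d. c l * w l $ r) + c d * (if r = p then 1 else 0)) * y $ r)"
      using e by simp
    also have "\<dots> = (\<Sum>r<n. \<Sum>l<d. c l * (w l $ r * y $ r)) + (\<Sum>r<n. if r = p then c d * y $ p else 0)"
      unfolding sum.distrib[symmetric]
      by (intro sum.cong) (auto simp: algebra_simps sum_distrib_left sum_distrib_right)
    also have "(\<Sum>r<n. \<Sum>l<d. c l * (w l $ r * y $ r)) = (\<Sum>l<d. c l * (\<Sum>r<n. w l $ r * y $ r))"
      by (subst sum.swap) (simp add: sum_distrib_left)
    finally have cd: "c d = 0" using p orth by simp
    then have "lincomb n d c w = 0\<^sub>v n" using e by (intro eq_vecI) auto
    then show ?thesis using w cd k by (auto simp: indep_family_def less_Suc_eq)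
  qed
  then have "indep_family n (Suc d) (w(d := unit_vec n p))"
    using w by (auto simp: indep_family_def less_Suc_eq)
  then show ?thesis ..
qed

lemma indep_family_extend:
  assumes "indep_family n d w" and "d \<le> n"
  shows "\<exists>z. indep_family n n z \<and> (\<forall>k<d. z k = w k)"
  using assms
proof (induction "n - d" arbitrary: d w)
  case 0
  then show ?case by auto
next
  case (Suc j)
  have "d < n" using Suc(2) by linarith
  then obtain u where u: "indep_family n (Suc d) (w(d := u))"
    using indep_family_extend_one[OF Suc(3)] by auto
  have "j = n - Suc d" "Suc d \<le> n" using Suc by auto
  from Suc(1)[OF this(1) u this(2)] show ?case by auto
qed

lemma lincomb_append:
  assumes "\<forall>k<m. w k \<in> carrier_vec n" "\<forall>k<d. v k \<in> carrier_vec n"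
  shows "lincomb n (m + d) c (append_family m w v)
    = lincomb n m c w + lincomb n d (\<lambda>k. c (m + k)) v"
proof -
  show ?thesis
    by (intro eq_vecI) (simp_all add: sum_lessThan_add append_family_def)
qed

lemma family_span_add: "x \<in> family_span n d w \<Longrightarrow> y \<in> family_span n d w \<Longrightarrow> x + y \<in> family_span n d w"
proof -
  assume "x \<in> family_span n d w" "y \<in> family_span n d w"
  then obtain a b where "x = lincomb n d a w" "y = lincomb n d b w" by (auto simp: family_span_def)
  then have "x + y = lincomb n d (\<lambda>k. a k + b k) w"
    by (intro eq_vecI) (auto simp: sum.distrib algebra_simps)
  then show ?thesis by (auto simp: family_span_def)
qed

lemma family_span_smult: "x \<in> family_span n d w \<Longrightarrow> t \<cdot>\<^sub>v x \<in> family_span n d w"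
proof -
  assume "x \<in> family_span n d w"
  then obtain a where "x = lincomb n d a w" by (auto simp: family_span_def)
  then have "t \<cdot>\<^sub>v x = lincomb n d (\<lambda>k. t * a k) w"
    by (intro eq_vecI) (auto simp: sum_distrib_left algebra_simps)
  then show ?thesis by (auto simp: family_span_def)
qed

lemma family_span_zero: "0\<^sub>v n \<in> family_span n d w"
proof -
  have "0\<^sub>v n = lincomb n d (\<lambda>_. 0) w" by (intro eq_vecI) auto
  then show ?thesis unfolding family_span_def by blast
qed

lemma family_span_diff: "x \<in> family_span n d w \<Longrightarrow> y \<in> family_span n d w \<Longrightarrow> x - y \<in> family_span n d w"
proof -
  assume x: "x \<in> family_span n d w" and y: "y \<in> family_span n d w"
  have "x + (-1) \<cdot>\<^sub>v y \<in> family_span n d w"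
    by (intro family_span_add family_span_smult x y)
  moreover have "x + (-1) \<cdot>\<^sub>v y = x - y"
    using x y by (intro eq_vecI) (auto simp: family_span_def)
  ultimately show ?thesis by simp
qed

text \<open>The vectors that complete \<open>w\<close> to a basis of the whole space represent a
  basis of the quotient. This is how the dimension of the quotient is obtained from that of the
  subspace.\<close>

lemma quot_basis_exists:
  assumes w: "indep_family n m w" and "m \<le> n"
  shows "\<exists>v. quot_basis n (family_span n m w) (n - m) v"
proof -
  define d where "d = n - m"
  have n: "n = m + d" using assms by (simp add: d_def)
  obtain z where z: "indep_family n n z" "\<forall>k<m. z k = w k"
    using indep_family_extend[OF assms] by auto
  define v where "v k = z (m + k)" for k
  have wc: "\<forall>k<m. w k \<in> carrier_vec n" and vc: "\<forall>k<d. v k \<in> carrier_vec n"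
    using w z(1) n by (auto simp: indep_family_def v_def)
  have "lincomb n n c z = lincomb n (m + d) c (append_family m w v)" for c
    unfolding n using z(2) by (intro lincomb_cong) (auto simp: append_family_def v_def)
  then have split: "lincomb n n c z = lincomb n m c w + lincomb n d (\<lambda>k. c (m + k)) v" for c
    using lincomb_append[OF wc vc] by simp
  have "c k = 0" if c: "lincomb n d c v \<in> family_span n m w" and "k < d" for c k
  proof -
    obtain a where a: "lincomb n d c v = lincomb n m a w" using c by (auto simp: family_span_def)
    \<comment> \<open>The equality of a combination of \<open>v\<close> with one of \<open>w\<close>
      is turned into a vanishing combination of the full basis \<open>z\<close>, hence the sign on
      the first \<open>m\<close> coefficients.\<close>
    define b where "b l = (if l < m then - a l else c (l - m))" for l
    have "lincomb n m b w = lincomb n m (\<lambda>l. - a l) w" by (intro lincomb_cong) (auto simp: b_def)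
    then have "lincomb n n b z = lincomb n m (\<lambda>l. - a l) w + lincomb n m a w"
      using split[of b] a by (simp add: b_def)
    also have "\<dots> = 0\<^sub>v n" by (intro eq_vecI) (auto simp: sum_negf)
    finally have "\<forall>l<n. b l = 0" using z(1) by (simp add: indep_family_def)
    then have "b (m + k) = 0" using \<open>k < d\<close> n by simp
    then show ?thesis by (simp add: b_def)
  qed
  moreover have "\<exists>c. u - lincomb n d c v \<in> family_span n m w" if u: "u \<in> carrier_vec n" for u
  proof -
    obtain c where "u = lincomb n n c z"
      using indep_family_spans[OF z(1) u] by (auto simp: family_span_def)
    then have "u - lincomb n d (\<lambda>k. c (m + k)) v = lincomb n m c w"
      unfolding split by (intro eq_vecI) auto
    then show ?thesis unfolding family_span_def by (metis rangeI)
  qed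
  ultimately have "quot_basis n (family_span n m w) d v"
    using vc by (simp add: quot_basis_def)
  then show ?thesis unfolding d_def by blast
qed

text \<open>A vanishing combination puts its \<open>v\<close>-part into the span of
  \<open>w\<close>, where \<open>quot_basis\<close> forces the coefficients to be zero. What remains
  is a relation among \<open>w\<close> alone.\<close>

lemma quot_basis_append_indep:
  assumes w: "indep_family n m w" and v: "quot_basis n (family_span n m w) d v"
  shows "indep_family n (m + d) (append_family m w v)"
proof -
  have wc: "\<forall>k<m. w k \<in> carrier_vec n" and vc: "\<forall>k<d. v k \<in> carrier_vec n"
    using w v by (auto simp: indep_family_def quot_basis_def)
  have "c k = 0" if c: "lincomb n (m + d) c (append_family m w v) = 0\<^sub>v n" and k: "k < m + d" for c k
  proof -
    have 0: "lincomb n m c w + lincomb n d (\<lambda>k. c (m + k)) v = 0\<^sub>v n"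
      using c lincomb_append[OF wc vc] by simp
    have "lincomb n d (\<lambda>k. c (m + k)) v = lincomb n m (\<lambda>l. - c l) w"
    proof (rule eq_vecI)
      fix r assume "r < dim_vec (lincomb n m (\<lambda>l. - c l) w)"
      then have r: "r < n" by simp
      have "(lincomb n m c w + lincomb n d (\<lambda>k. c (m + k)) v) $ r = 0" using 0 r by simp
      then show "lincomb n d (\<lambda>k. c (m + k)) v $ r = lincomb n m (\<lambda>l. - c l) w $ r"
        using r by (simp add: sum_negf eq_neg_iff_add_eq_0 add.commute)
    qed simp
    then have "lincomb n d (\<lambda>k. c (m + k)) v \<in> family_span n m w" by (auto simp: family_span_def)
    then have v0: "\<forall>l<d. c (m + l) = 0"
      using v unfolding quot_basis_def by (elim conjE allE[where x = "\<lambda>k. c (m + k)"]) simp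
    then have "lincomb n d (\<lambda>k. c (m + k)) v = 0\<^sub>v n" by (intro eq_vecI) auto
    then have "lincomb n m c w = 0\<^sub>v n" using 0 right_zero_vec[OF lincomb_carrier] by metis
    then have w0: "\<forall>l<m. c l = 0" using w by (auto simp: indep_family_def)
    show ?thesis
    proof (cases "k < m")
      case False
      then have "k = m + (k - m)" "k - m < d" using k by auto
      then show ?thesis using v0 by metis
    qed (use w0 in auto)
  qed
  then show ?thesis using wc vc by (auto simp: indep_family_def append_family_def)
qed

section \<open>Endomorphisms induced on a quotient\<close>

text \<open>In the basis made of \<open>w\<close> followed by \<open>v\<close>, the operator is
  block upper triangular: the eigenvalues \<open>\<mu>\<close> fill the first diagonal block and
  \<open>Ab\<close> is the second.\<close>

lemma induced_mat_det:
  assumes w: "indep_family n m w" and v: "quot_basis n (family_span n m w) d v"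
    and n: "n = m + d" and A: "A \<in> carrier_mat n n"
    and eig: "\<And>k. k < m \<Longrightarrow> A *\<^sub>v w k = \<mu> k \<cdot>\<^sub>v w k"
    and Ab: "induced_mat n (family_span n m w) d v A Ab"
  shows "det A = (\<Prod>k<m. \<mu> k) * det Ab"
proof -
  have wc: "\<forall>k<m. w k \<in> carrier_vec n" and vc: "\<forall>k<d. v k \<in> carrier_vec n"
    using w v by (auto simp: indep_family_def quot_basis_def)
  have Abc: "Ab \<in> carrier_mat d d"
    and Abv: "\<And>j. j < d \<Longrightarrow> A *\<^sub>v v j - lincomb n d (\<lambda>k. Ab $$ (k, j)) v \<in> family_span n m w"
    using Ab by (auto simp: induced_mat_def)
  \<comment> \<open>The coefficients \<open>a j\<close> record the part of
    \<open>A *\<^sub>v v j\<close> that the quotient forgets. They form the upper right block of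
    \<open>T\<close>.\<close>
  have "\<forall>j. \<exists>a. j < d \<longrightarrow> A *\<^sub>v v j - lincomb n d (\<lambda>k. Ab $$ (k, j)) v = lincomb n m a w"
    using Abv by (auto simp: family_span_def)
  then obtain a where a: "\<And>j. j < d \<Longrightarrow>
      A *\<^sub>v v j - lincomb n d (\<lambda>k. Ab $$ (k, j)) v = lincomb n m (a j) w" by metis
  define z where "z = append_family m w v"
  have z: "indep_family n n z"
    unfolding z_def using quot_basis_append_indep[OF w v] by (simp add: n)
  have zc: "\<And>k. k < n \<Longrightarrow> z k \<in> carrier_vec n" using z by (auto simp: indep_family_def)
  define T where "T = four_block_mat (mat_diag m \<mu>) (mat m d (\<lambda>(l,j). a j l)) (0\<^sub>m d m) Ab"
  have dT: "det T = (\<Prod>k<m. \<mu> k) * det Ab"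
    unfolding T_def
    using det_four_block_mat_lower_left_zero[of "mat_diag m \<mu>" m "mat m d (\<lambda>(l,j). a j l)" d "0\<^sub>m d m" Ab]
      Abc by (simp add: det_mat_diag)
  have Tc: "T \<in> carrier_mat n n" unfolding T_def n using Abc by simp
  \<comment> \<open>This is the change of basis, checked by columns: column \<open>k\<close> of
    \<open>T\<close> holds the coordinates of \<open>A *\<^sub>v z k\<close> with respect to
    \<open>z\<close>. As \<open>colmat n n z\<close> is invertible, the determinants of
    \<open>A\<close> and \<open>T\<close> agree.\<close>
  have "A * colmat n n z = colmat n n z * T"
  proof (rule mat_col_eqI)
    fix k assume "k < dim_col (colmat n n z * T)"
    then have k: "k < n" using Tc by simp
    have "col (A * colmat n n z) k = A *\<^sub>v z k"
      using col_mult2[OF A colmat_carrier k] col_colmat[of k n z n] k zc by simp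
    also have "\<dots> = lincomb n n (\<lambda>l. T $$ (l, k)) z"
    proof (cases "k < m")
      case True
      have "lincomb n n (\<lambda>l. T $$ (l, k)) z = lincomb n m (\<lambda>l. T $$ (l, k)) w
          + lincomb n d (\<lambda>l. T $$ (m + l, k)) v"
        unfolding z_def using lincomb_append[OF wc vc] n by simp
      also have "lincomb n m (\<lambda>l. T $$ (l, k)) w = \<mu> k \<cdot>\<^sub>v w k"
      proof (rule eq_vecI)
        fix r assume "r < dim_vec (\<mu> k \<cdot>\<^sub>v w k)"
        then have r: "r < n" using wc True by auto
        have "lincomb n m (\<lambda>l. T $$ (l, k)) w $ r = (\<Sum>l<m. if l = k then \<mu> k * w k $ r else 0)"
          unfolding lincomb_index[OF r]
          using r True Abc by (intro sum.cong) (auto simp: T_def mat_diag_def)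
        then show "lincomb n m (\<lambda>l. T $$ (l, k)) w $ r = (\<mu> k \<cdot>\<^sub>v w k) $ r"
          using r True wc by auto
      qed (use wc True in auto)
      also have "lincomb n d (\<lambda>l. T $$ (m + l, k)) v = 0\<^sub>v n"
        using True Abc by (intro eq_vecI) (auto simp: T_def mat_diag_def intro!: sum.neutral)
      finally have "lincomb n n (\<lambda>l. T $$ (l, k)) z = \<mu> k \<cdot>\<^sub>v w k" using True wc by simp
      moreover have "z k = w k" using True by (simp add: z_def append_family_def)
      ultimately show ?thesis using eig[OF True] by simp
    next
      case False
      define j where "j = k - m"
      have j: "j < d" "k = m + j" using False k n by (auto simp: j_def)
      have "lincomb n n (\<lambda>l. T $$ (l, k)) z = lincomb n m (\<lambda>l. T $$ (l, k)) w
          + lincomb n d (\<lambda>l. T $$ (m + l, k)) v"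
        unfolding z_def using lincomb_append[OF wc vc] n by simp
      also have "lincomb n m (\<lambda>l. T $$ (l, k)) w = lincomb n m (a j) w"
        using j Abc by (intro lincomb_cong) (auto simp: T_def mat_diag_def)
      also have "lincomb n d (\<lambda>l. T $$ (m + l, k)) v = lincomb n d (\<lambda>l. Ab $$ (l, j)) v"
        using j Abc by (intro lincomb_cong) (auto simp: T_def mat_diag_def)
      also have "lincomb n m (a j) w + lincomb n d (\<lambda>l. Ab $$ (l, j)) v = A *\<^sub>v v j"
        unfolding a[OF j(1), symmetric] using A by (intro eq_vecI) auto
      finally have "lincomb n n (\<lambda>l. T $$ (l, k)) z = A *\<^sub>v v j" .
      moreover have "z k = v j" using j by (simp add: z_def append_family_def)
      ultimately show ?thesis by simp
    qed
    also have "\<dots> = colmat n n z *\<^sub>v col T k"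
      using Tc k by (subst colmat_mult_vec) (auto intro!: lincomb_cong)
    also have "\<dots> = col (colmat n n z * T) k"
      using col_mult2[OF colmat_carrier Tc k] by simp
    finally show "col (A * colmat n n z) k = col (colmat n n z * T) k" .
  qed (use A Tc in \<open>auto simp: colmat_def\<close>)
  then have "det A * det (colmat n n z) = det (colmat n n z) * det T"
    using det_mult[OF A colmat_carrier] det_mult[OF colmat_carrier Tc] by metis
  then show ?thesis using indep_family_det[OF z] dT by simp
qed

text \<open>\<open>induced_mat\<close> is a relation between an operator and a matrix, so linearity
  takes the form of closure properties. Together with those for multiples and the identity, this one
  builds the matrix induced by \<open>I - (1-q) x \<Sum> G_i / (x + e_i)\<close> from the given
  \<open>Gb\<close>.\<close>

lemma induced_mat_add:
  assumes v: "quot_basis n (family_span n m w) d v"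
    and A: "A \<in> carrier_mat n n" "induced_mat n (family_span n m w) d v A Ab"
    and A': "A' \<in> carrier_mat n n" "induced_mat n (family_span n m w) d v A' Ab'"
  shows "induced_mat n (family_span n m w) d v (A + A') (Ab + Ab')"
proof -
  have "(A + A') *\<^sub>v v j - lincomb n d (\<lambda>k. (Ab + Ab') $$ (k, j)) v \<in> family_span n m w"
    if j: "j < d" for j
  proof -
    have vj: "v j \<in> carrier_vec n" using v j by (simp add: quot_basis_def)
    have "(A + A') *\<^sub>v v j - lincomb n d (\<lambda>k. (Ab + Ab') $$ (k, j)) v =
        (A *\<^sub>v v j - lincomb n d (\<lambda>k. Ab $$ (k, j)) v) + (A' *\<^sub>v v j - lincomb n d (\<lambda>k. Ab' $$ (k, j)) v)"
      using A A' j vj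
      by (intro eq_vecI)
         (auto simp: induced_mat_def add_scalar_prod_distrib[of _ n] sum.distrib algebra_simps)
    then show ?thesis using A A' j by (auto simp: induced_mat_def intro!: family_span_add)
  qed
  then show ?thesis using A A' by (auto simp: induced_mat_def)
qed

lemma induced_mat_smult:
  assumes v: "quot_basis n (family_span n m w) d v"
    and A: "A \<in> carrier_mat n n" "induced_mat n (family_span n m w) d v A Ab"
  shows "induced_mat n (family_span n m w) d v (t \<cdot>\<^sub>m A) (t \<cdot>\<^sub>m Ab)"
proof -
  have "(t \<cdot>\<^sub>m A) *\<^sub>v v j - lincomb n d (\<lambda>k. (t \<cdot>\<^sub>m Ab) $$ (k, j)) v \<in> family_span n m w"
    if j: "j < d" for j
  proof -
    have vj: "v j \<in> carrier_vec n" using v j by (simp add: quot_basis_def)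
    have "(t \<cdot>\<^sub>m A) *\<^sub>v v j - lincomb n d (\<lambda>k. (t \<cdot>\<^sub>m Ab) $$ (k, j)) v =
        t \<cdot>\<^sub>v (A *\<^sub>v v j - lincomb n d (\<lambda>k. Ab $$ (k, j)) v)"
      using A j vj
      by (intro eq_vecI)
         (auto simp: induced_mat_def sum_distrib_left algebra_simps)
    then show ?thesis using A j by (auto simp: induced_mat_def intro!: family_span_smult)
  qed
  then show ?thesis using A by (auto simp: induced_mat_def)
qed

lemma induced_mat_one:
  assumes v: "quot_basis n (family_span n m w) d v"
  shows "induced_mat n (family_span n m w) d v (1\<^sub>m n) (1\<^sub>m d)"
proof -
  have "1\<^sub>m n *\<^sub>v v j - lincomb n d (\<lambda>k. 1\<^sub>m d $$ (k, j)) v \<in> family_span n m w"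
    if j: "j < d" for j
  proof -
    have vj: "v j \<in> carrier_vec n" using v j by (simp add: quot_basis_def)
    have "(\<Sum>k<d. 1\<^sub>m d $$ (k, j) * v k $ r) = (\<Sum>k<d. if k = j then v j $ r else 0)" for r
      using j by (intro sum.cong) auto
    then have "1\<^sub>m n *\<^sub>v v j - lincomb n d (\<lambda>k. 1\<^sub>m d $$ (k, j)) v = 0\<^sub>v n"
      using j vj by (intro eq_vecI) auto
    then show ?thesis by (simp add: family_span_zero)
  qed
  then show ?thesis by (auto simp: induced_mat_def)
qed

text \<open>Operators that agree on \<open>v\<close> modulo the subspace induce the same matrix: the
  difference of corresponding columns gives a combination of \<open>v\<close> in the subspace, so it
  vanishes. Two different operators are allowed because the sum of the \<open>G_i\<close> has to be
  compared with a scalar that it equals only modulo the subspace.\<close>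

lemma induced_mat_unique:
  assumes v: "quot_basis n (family_span n m w) d v"
    and A: "A \<in> carrier_mat n n" "induced_mat n (family_span n m w) d v A Ab"
    and A': "A' \<in> carrier_mat n n" "induced_mat n (family_span n m w) d v A' Ab'"
    and eq: "\<And>j. j < d \<Longrightarrow> A *\<^sub>v v j - A' *\<^sub>v v j \<in> family_span n m w"
  shows "Ab = Ab'"
proof (rule eq_matI)
  have Abc: "Ab \<in> carrier_mat d d" "Ab' \<in> carrier_mat d d"
    using A A' by (auto simp: induced_mat_def)
  show "dim_row Ab = dim_row Ab'" "dim_col Ab = dim_col Ab'" using Abc by auto
  fix i j assume "i < dim_row Ab'" "j < dim_col Ab'"
  then have i: "i < d" and j: "j < d" using Abc by auto
  have vj: "v j \<in> carrier_vec n" using v j by (simp add: quot_basis_def)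
  have "lincomb n d (\<lambda>k. Ab $$ (k, j) - Ab' $$ (k, j)) v =
     (A *\<^sub>v v j - A' *\<^sub>v v j) - (A *\<^sub>v v j - lincomb n d (\<lambda>k. Ab $$ (k, j)) v)
       + (A' *\<^sub>v v j - lincomb n d (\<lambda>k. Ab' $$ (k, j)) v)"
    using A A' vj by (intro eq_vecI) (auto simp: sum_subtractf algebra_simps)
  also have "\<dots> \<in> family_span n m w"
    using A(2) A'(2) eq[OF j] j unfolding induced_mat_def
    by (blast intro: family_span_add family_span_diff)
  finally have "\<forall>k<d. Ab $$ (k, j) - Ab' $$ (k, j) = 0"
    using v unfolding quot_basis_def
    by (elim conjE allE[where x = "\<lambda>k. Ab $$ (k, j) - Ab' $$ (k, j)"]) simp
  then show "Ab $$ (i, j) = Ab' $$ (i, j)" using i by simp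
qed

section \<open>Determinant of a low rank perturbation of a block scalar matrix\<close>

text \<open>This is the matrix determinant lemma. The block matrix with rows \<open>D, U\<close> and
  \<open>V, 1\<close> is factored in two ways, by the Schur complement of the identity block and by
  that of \<open>D\<close>, and the two values of its determinant are compared.\<close>

lemma det_minus_mult_commute:
  assumes D: "D \<in> carrier_mat n n" and D': "D' \<in> carrier_mat n n" and DD': "D * D' = 1\<^sub>m n"
    and U: "U \<in> carrier_mat n m" and V: "V \<in> carrier_mat m n"
  shows "det (D - U * V) = det D * det (1\<^sub>m m - V * D' * U :: complex mat)"
proof -
  have D'D: "D' * D = 1\<^sub>m n" by (rule mat_mult_left_right_inverse[OF D D' DD'])
  let ?X = "four_block_mat D U V (1\<^sub>m m)"
  have 1: "four_block_mat (D - U * V) U (0\<^sub>m m n) (1\<^sub>m m) * four_block_mat (1\<^sub>m n) (0\<^sub>m n m) V (1\<^sub>m m) = ?X"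
    using assms
    by (subst mult_four_block_mat[where ?nr1.0=n and ?n1.0=n and ?n2.0=m and ?nr2.0=m and ?nc1.0=n and ?nc2.0=m])
       (auto intro!: cong_four_block_mat)
  have VD: "V * D' * D = V" using assms D'D by (simp add: assoc_mult_mat[of _ m n _ n _ n])
  have 2: "four_block_mat (1\<^sub>m n) (0\<^sub>m n m) (V * D') (1\<^sub>m m) * four_block_mat D U (0\<^sub>m m n) (1\<^sub>m m - V * D' * U) = ?X"
    using assms VD
    by (subst mult_four_block_mat[where ?nr1.0=n and ?n1.0=n and ?n2.0=m and ?nr2.0=m and ?nc1.0=n and ?nc2.0=m])
       (auto intro!: cong_four_block_mat eq_matI)
  have UV: "D - U * V \<in> carrier_mat n n" using U V by (simp add: minus_carrier_mat)
  have "det ?X = det (D - U * V)"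
    unfolding 1[symmetric]
    using assms UV by (subst det_mult[of _ "n + m"])
      (simp_all add: det_four_block_mat_lower_left_zero[of _ n _ m] det_four_block_mat_upper_right_zero[of _ n _ m])
  moreover have VDU: "1\<^sub>m m - V * D' * U \<in> carrier_mat m m"
    using assms by (simp add: minus_carrier_mat)
  have "det ?X = det D * det (1\<^sub>m m - V * D' * U)"
    unfolding 2[symmetric]
    using assms VDU by (subst det_mult[of _ "n + m"])
      (simp_all del: assoc_mult_mat add: det_four_block_mat_lower_left_zero[of _ n _ m] det_four_block_mat_upper_right_zero[of _ n _ m])
  ultimately show ?thesis by simp
qed

lemma sum_blocks: "(\<Sum>c<M*N. f c) = (\<Sum>j<N. \<Sum>b<M. f (j*M + b))" for f :: "nat \<Rightarrow> 'a::comm_monoid_add"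
proof -
  have "(\<Sum>j<N. \<Sum>b<M. f (j*M + b)) = (\<Sum>j<N. sum f {j*M ..< j*M + M})"
  proof (rule sum.cong[OF refl])
    fix j
    show "(\<Sum>b<M. f (j*M + b)) = sum f {j*M ..< j*M + M}"
      using sum.shift_bounds_nat_ivl[of f 0 "j*M" M] by (simp add: lessThan_atLeast0 add.commute)
  qed
  then show ?thesis by (simp add: sum.nat_group mult.commute)
qed

lemma prod_blocks: "(\<Prod>c<M*N. g (c div M)) = (\<Prod>j<N. g j) ^ M" for g :: "nat \<Rightarrow> 'a::comm_monoid_mult"
proof (induction N)
  case (Suc N)
  have "{..<M * Suc N} = {..<M*N} \<union> {M*N..<M*N+M}" by auto
  then have "(\<Prod>c<M * Suc N. g (c div M)) = (\<Prod>c<M*N. g (c div M)) * (\<Prod>c=M*N..<M*N+M. g (c div M))"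
    by (simp add: prod.union_disjoint ivl_disj_int)
  also have "(\<Prod>c=M*N..<M*N+M. g (c div M)) = (\<Prod>c=M*N..<M*N+M. g N)"
  proof (rule prod.cong[OF refl])
    fix c assume "c \<in> {M*N..<M*N+M}"
    then have "c div M = N" by (intro div_nat_eqI) (auto simp: mult.commute)
    then show "g (c div M) = g N" by simp
  qed
  finally show ?case using Suc by (simp add: power_mult_distrib)
qed simp

text \<open>Block \<open>(i, j)\<close> is \<open>f i\<close> times the identity if
  \<open>i = j\<close>, and zero otherwise, minus \<open>g i\<close> times \<open>B j\<close>. Both
  the sum of the \<open>G_i\<close> and the operator \<open>I - \<Sum> \<alpha>_i G_i\<close> have
  this shape, so that one computation covers the two.\<close>

definition block_resolvent :: "nat \<Rightarrow> nat \<Rightarrow> (nat \<Rightarrow> complex mat) \<Rightarrow> (nat \<Rightarrow> complex) \<Rightarrow> (nat \<Rightarrow> complex) \<Rightarrow> complex mat" where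
  "block_resolvent M N B f g = mat (M*N) (M*N) (\<lambda>(r,c).
     (if r = c then f (r div M) else 0) - g (r div M) * B (c div M) $$ (r mod M, c mod M))"

text \<open>The subtracted part factors as \<open>U * V\<close>, where \<open>U\<close> stacks the
  multiples \<open>g j\<close> of the identity and \<open>V\<close> is the row of all
  \<open>B j\<close>. The matrix determinant lemma thus replaces a determinant of size
  \<open>M*N\<close> by one of size \<open>M\<close>.\<close>

lemma det_block_resolvent:
  assumes M: "0 < M" and f: "\<And>j. j < N \<Longrightarrow> f j \<noteq> 0"
  shows "det (block_resolvent M N B f g) =
     (\<Prod>j<N. f j) ^ M * det (1\<^sub>m M - mat M M (\<lambda>(a,b). \<Sum>j<N. g j / f j * B j $$ (a,b)))"
proof -
  let ?n = "M*N"
  define D where "D = mat_diag ?n (\<lambda>r. f (r div M))"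
  define D' where "D' = mat_diag ?n (\<lambda>r. 1 / f (r div M))"
  define U where "U = mat ?n M (\<lambda>(r,a). if r mod M = a then g (r div M) else 0)"
  define V where "V = mat M ?n (\<lambda>(a,c). B (c div M) $$ (a, c mod M))"
  have c: "D \<in> carrier_mat ?n ?n" "D' \<in> carrier_mat ?n ?n" "U \<in> carrier_mat ?n M" "V \<in> carrier_mat M ?n"
    by (auto simp: D_def D'_def U_def V_def mat_diag_def)
  have fr: "f (r div M) \<noteq> 0" if "r < ?n" for r
    using that f by (simp add: less_mult_imp_div_less mult.commute)
  have DD': "D * D' = 1\<^sub>m ?n"
    unfolding D_def D'_def mat_diag_diag by (rule eq_matI) (auto simp: mat_diag_def fr)
  have UV: "(U * V) $$ (r, c) = g (r div M) * B (c div M) $$ (r mod M, c mod M)" if "r < ?n" "c < ?n" for r c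
  proof -
    have "(U * V) $$ (r, c) = (\<Sum>a = 0..<M. U $$ (r, a) * V $$ (a, c))"
      using that c by (simp add: scalar_prod_def)
    also have "\<dots> = (\<Sum>a = 0..<M. if a = r mod M then g (r div M) * B (c div M) $$ (r mod M, c mod M) else 0)"
      using that by (intro sum.cong) (auto simp: U_def V_def)
    finally show ?thesis using M by simp
  qed
  have "block_resolvent M N B f g = D - U * V"
    by (rule eq_matI) (use c UV in \<open>auto simp: block_resolvent_def D_def mat_diag_def\<close>)
  moreover have "det D = (\<Prod>j<N. f j) ^ M"
    unfolding D_def det_mat_diag by (rule prod_blocks)
  moreover have "V * D' * U = mat M M (\<lambda>(a,b). \<Sum>j<N. g j / f j * B j $$ (a,b))"
  proof (rule eq_matI)
    fix a b assume "a < dim_row (mat M M (\<lambda>(a,b). \<Sum>j<N. g j / f j * B j $$ (a,b)))"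
      "b < dim_col (mat M M (\<lambda>(a,b). \<Sum>j<N. g j / f j * B j $$ (a,b)))"
    then have ab: "a < M" "b < M" by auto
    have VD: "V * D' = mat M ?n (\<lambda>(a,c). V $$ (a,c) * (1 / f (c div M)))"
      unfolding D'_def by (rule mat_diag_mult_right) (use c in auto)
    have "(V * D' * U) $$ (a, b) = (\<Sum>c<M*N. V $$ (a,c) * (1 / f (c div M)) * U $$ (c,b))"
      unfolding VD using ab c(3) by (auto simp: scalar_prod_def lessThan_atLeast0 intro!: sum.cong)
    also have "\<dots> = (\<Sum>c<M*N. if c mod M = b then g (c div M) / f (c div M) * B (c div M) $$ (a, b) else 0)"
      using ab by (intro sum.cong) (auto simp: U_def V_def)
    also have "\<dots> = (\<Sum>j<N. g j / f j * B j $$ (a,b))"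
      unfolding sum_blocks using ab by (intro sum.cong) auto
    finally show "(V * D' * U) $$ (a, b) = mat M M (\<lambda>(a,b). \<Sum>j<N. g j / f j * B j $$ (a,b)) $$ (a, b)"
      using ab by simp
  qed (use c in auto)
  ultimately show ?thesis using det_minus_mult_commute[OF c(1,2) DD' c(3,4)] by simp
qed

section \<open>Middle convolution when the residues sum to a scalar and have one-dimensional
  kernels\<close>

text \<open>The relation \<open>ql * \<beta> + lb = 0\<close> is the resonance that makes the sum of
  the \<open>G_i\<close> annihilate all diagonal vectors, so that \<open>qmc_L\<close> is not
  trivial. The vector \<open>u j\<close> spans the kernel of \<open>B j\<close>.\<close>

locale scalar_residue_sum =
  fixes M N :: nat and B :: "nat \<Rightarrow> complex mat" and ql lb \<beta> :: complex and u :: "nat \<Rightarrow> complex vec"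
  assumes M_pos: "0 < M"
    and B_carrier: "\<And>j. j < N \<Longrightarrow> B j \<in> carrier_mat M M"
    and B_sum: "\<And>a b. a < M \<Longrightarrow> b < M \<Longrightarrow> (\<Sum>j<N. B j $$ (a,b)) = (if a = b then \<beta> else 0)"
    and ql_lb: "ql * \<beta> + lb = 0" and lb_nz: "lb \<noteq> 0"
    and u_carrier: "\<And>j. j < N \<Longrightarrow> u j \<in> carrier_vec M"
    and u_nz: "\<And>j. j < N \<Longrightarrow> u j \<noteq> 0\<^sub>v M"
    and B_u: "\<And>j. j < N \<Longrightarrow> B j *\<^sub>v u j = 0\<^sub>v M"
    and ker_B: "\<And>j y. j < N \<Longrightarrow> y \<in> carrier_vec M \<Longrightarrow> B j *\<^sub>v y = 0\<^sub>v M \<Longrightarrow> \<exists>c. y = c \<cdot>\<^sub>v u j"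
    and ker_inter: "\<And>y. y \<in> carrier_vec M \<Longrightarrow> (\<And>j. j < N \<Longrightarrow> B j *\<^sub>v y = 0\<^sub>v M) \<Longrightarrow> y = 0\<^sub>v M"
begin

text \<open>The first \<open>N\<close> vectors carry \<open>u k\<close> in block \<open>k\<close>
  and span \<open>qmc_K\<close>. The other \<open>M\<close> repeat a standard basis vector in every
  block and span \<open>qmc_L\<close>.\<close>

definition W_basis :: "nat \<Rightarrow> complex vec" where
  "W_basis k = (if k < N then vec (M*N) (\<lambda>r. if r div M = k then u k $ (r mod M) else 0)
          else vec (M*N) (\<lambda>r. if r mod M = k - N then 1 else 0))"

text \<open>This is entry \<open>a\<close> of the row of all \<open>B j\<close> applied to
  \<open>v\<close>. Every block row of the operators considered here depends on the other blocks of
  \<open>v\<close> only through this vector.\<close>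

definition row_value :: "complex vec \<Rightarrow> nat \<Rightarrow> complex" where
  "row_value v a = (\<Sum>c<M*N. B (c div M) $$ (a, c mod M) * v $ c)"

lemma W_basis_carrier: "W_basis k \<in> carrier_vec (M*N)"
  by (simp add: W_basis_def)

lemma B_zero: "j < N \<Longrightarrow> B j *\<^sub>v 0\<^sub>v M = 0\<^sub>v M"
  using B_carrier[of j] by (intro eq_vecI) auto

lemma div_less_N: "r < M*N \<Longrightarrow> r div M < N"
  by (simp add: less_mult_imp_div_less mult.commute)

lemma block_index_less: "j < N \<Longrightarrow> a < M \<Longrightarrow> j*M + a < M*N"
proof -
  assume "j < N" "a < M"
  then have "j*M + a < Suc j * M" by simp
  also have "\<dots> \<le> N * M" using \<open>j < N\<close> by (intro mult_le_mono1) simp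
  finally show ?thesis by (simp add: mult.commute)
qed

lemma row_value_blk:
  assumes "a < M"
  shows "row_value v a = (\<Sum>j<N. (B j *\<^sub>v blk M j v) $ a)"
  unfolding row_value_def sum_blocks
proof (rule sum.cong[OF refl])
  fix j assume "j \<in> {..<N}"
  then have "B j \<in> carrier_mat M M" using B_carrier by simp
  then show "(\<Sum>b<M. B ((j*M + b) div M) $$ (a, (j*M + b) mod M) * v $ (j*M + b)) = (B j *\<^sub>v blk M j v) $ a"
    using assms by (auto simp: blk_def scalar_prod_def lessThan_atLeast0 intro!: sum.cong)
qed

lemma block_resolvent_mult:
  assumes v: "v \<in> carrier_vec (M*N)" and r: "r < M*N"
  shows "(block_resolvent M N B f g *\<^sub>v v) $ r = f (r div M) * v $ r - g (r div M) * row_value v (r mod M)"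
proof -
  have "(block_resolvent M N B f g *\<^sub>v v) $ r
      = (\<Sum>c<M*N. ((if r = c then f (r div M) else 0) - g (r div M) * B (c div M) $$ (r mod M, c mod M)) * v $ c)"
    using v r by (auto simp: block_resolvent_def scalar_prod_def lessThan_atLeast0 intro!: sum.cong)
  also have "\<dots> = (\<Sum>c<M*N. (if c = r then f (r div M) * v $ r else 0)
      - g (r div M) * (B (c div M) $$ (r mod M, c mod M) * v $ c))"
    by (intro sum.cong) (auto simp: algebra_simps)
  also have "\<dots> = f (r div M) * v $ r - g (r div M) * row_value v (r mod M)"
    using r by (simp add: sum_subtractf row_value_def sum_distrib_left)
  finally show ?thesis .
qed

lemma block_resolvent_carrier: "block_resolvent M N B f g \<in> carrier_mat (M*N) (M*N)"
  by (simp add: block_resolvent_def)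

text \<open>Row \<open>r\<close> belongs to the single matrix \<open>G_i\<close> with
  \<open>i = r div M\<close>, so summation merely assembles the block rows. The weight is
  \<open>- ql\<close> because \<open>block_resolvent\<close> subtracts.\<close>

lemma qmc_Gsum_block_resolvent: "qmc_Gsum M N B ql lb = block_resolvent M N B (\<lambda>_. lb) (\<lambda>_. - ql)"
proof -
  let ?G = "qmc_G M N B ql lb"
  \<comment> \<open>An arbitrary index list makes the induction over \<open>foldr\<close> go
    through. The carrier statement is proved alongside because the entries of a sum are only
    controlled within the dimensions.\<close>
  have fold: "foldr (\<lambda>i acc. ?G i + acc) xs (0\<^sub>m (M*N) (M*N)) \<in> carrier_mat (M*N) (M*N) \<and>
     (\<forall>r<M*N. \<forall>c<M*N. foldr (\<lambda>i acc. ?G i + acc) xs (0\<^sub>m (M*N) (M*N)) $$ (r,c)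
        = sum_list (map (\<lambda>i. ?G i $$ (r,c)) xs))" for xs
    by (induction xs) auto
  show ?thesis
  proof (rule eq_matI)
    fix r c assume "r < dim_row (block_resolvent M N B (\<lambda>_. lb) (\<lambda>_. - ql))"
      "c < dim_col (block_resolvent M N B (\<lambda>_. lb) (\<lambda>_. - ql))"
    then have rc: "r < M*N" "c < M*N" by (auto simp: block_resolvent_def)
    have "qmc_Gsum M N B ql lb $$ (r,c) = (\<Sum>i<N. ?G i $$ (r,c))"
      using fold[of "[0..<N]"] rc
      by (simp add: qmc_Gsum_def interv_sum_list_conv_sum_set_nat lessThan_atLeast0)
    also have "\<dots> = (\<Sum>i<N. if i = r div M then ql * B (c div M) $$ (r mod M, c mod M) + (if r = c then lb else 0) else 0)"
      using rc by (intro sum.cong) (auto simp: qmc_G_def)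
    finally show "qmc_Gsum M N B ql lb $$ (r,c) = block_resolvent M N B (\<lambda>_. lb) (\<lambda>_. - ql) $$ (r,c)"
      using rc div_less_N by (simp add: block_resolvent_def)
  qed (use fold in \<open>auto simp: qmc_Gsum_def block_resolvent_def\<close>)
qed

text \<open>On a vector with equal blocks, the row of all \<open>B j\<close> acts as the sum of the
  \<open>B j\<close>, which is the scalar \<open>\<beta>\<close>.\<close>

lemma row_value_diagonal:
  assumes "y \<in> carrier_vec M" and a: "a < M"
  shows "row_value (vec (M*N) (\<lambda>r. y $ (r mod M))) a = \<beta> * y $ a"
proof -
  have "blk M j (vec (M*N) (\<lambda>r. y $ (r mod M))) = y" if "j < N" for j
    using assms that block_index_less by (intro eq_vecI) (auto simp: blk_def)
  then have "row_value (vec (M*N) (\<lambda>r. y $ (r mod M))) a = (\<Sum>j<N. (B j *\<^sub>v y) $ a)"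
    using row_value_blk[OF a] by simp
  also have "\<dots> = (\<Sum>j<N. \<Sum>b<M. B j $$ (a,b) * y $ b)"
  proof (rule sum.cong[OF refl])
    fix j assume "j \<in> {..<N}"
    then have "B j \<in> carrier_mat M M" using B_carrier by simp
    then show "(B j *\<^sub>v y) $ a = (\<Sum>b<M. B j $$ (a,b) * y $ b)"
      using assms by (auto simp: scalar_prod_def lessThan_atLeast0 intro!: sum.cong)
  qed
  also have "\<dots> = (\<Sum>b<M. (\<Sum>j<N. B j $$ (a,b)) * y $ b)"
    by (subst sum.swap) (simp add: sum_distrib_right)
  also have "\<dots> = (\<Sum>b<M. if b = a then \<beta> * y $ a else 0)"
    using a by (intro sum.cong) (auto simp: B_sum)
  finally show ?thesis using a by simp
qed

text \<open>The kernel equation expresses \<open>lb * v $ r\<close> through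
  \<open>row_value\<close>, which depends only on \<open>r mod M\<close>. As \<open>lb\<close> is
  nonzero, all blocks of \<open>v\<close> coincide. Conversely, the sum acts on a diagonal vector by
  \<open>ql * \<beta> + lb = 0\<close>.\<close>

lemma qmc_L_diagonal:
  "qmc_L M N B ql lb = {vec (M*N) (\<lambda>r. y $ (r mod M)) | y. y \<in> carrier_vec M}" (is "_ = ?R")
proof
  show "qmc_L M N B ql lb \<subseteq> ?R"
  proof
    fix v assume "v \<in> qmc_L M N B ql lb"
    then have v: "v \<in> carrier_vec (M*N)" and 0: "qmc_Gsum M N B ql lb *\<^sub>v v = 0\<^sub>v (M*N)"
      by (auto simp: qmc_L_def)
    have e: "lb * v $ r + ql * row_value v (r mod M) = 0" if r: "r < M*N" for r
    proof -
      have "(qmc_Gsum M N B ql lb *\<^sub>v v) $ r = 0" using 0 r by simp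
      then show ?thesis unfolding qmc_Gsum_block_resolvent block_resolvent_mult[OF v r] by simp
    qed
    define y where "y = vec M (\<lambda>a. v $ a)"
    have "v = vec (M*N) (\<lambda>r. y $ (r mod M))"
    proof (rule eq_vecI)
      fix r assume "r < dim_vec (vec (M*N) (\<lambda>r. y $ (r mod M)))"
      then have r: "r < M*N" by simp
      then have r': "r mod M < M * N" by (meson le_less_trans mod_less_eq_dividend)
      have "lb * v $ r = lb * v $ (r mod M)" using e[OF r] e[OF r']
        by (metis add_right_cancel mod_mod_trivial)
      then show "v $ r = vec (M*N) (\<lambda>r. y $ (r mod M)) $ r"
        using r lb_nz M_pos by (simp add: y_def)
    qed (use v in auto)
    then show "v \<in> ?R" by (auto simp: y_def)
  qed
  show "?R \<subseteq> qmc_L M N B ql lb"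
  proof
    fix v assume "v \<in> ?R"
    then obtain y where y: "y \<in> carrier_vec M" and v: "v = vec (M*N) (\<lambda>r. y $ (r mod M))" by auto
    have "(qmc_Gsum M N B ql lb *\<^sub>v v) $ r = 0" if r: "r < M*N" for r
    proof -
      have "(qmc_Gsum M N B ql lb *\<^sub>v v) $ r = (ql * \<beta> + lb) * y $ (r mod M)"
        unfolding qmc_Gsum_block_resolvent
        using r M_pos y by (subst block_resolvent_mult) (auto simp: v row_value_diagonal algebra_simps)
      then show ?thesis by (simp add: ql_lb)
    qed
    then have "qmc_Gsum M N B ql lb *\<^sub>v v = 0\<^sub>v (M*N)"
      using qmc_Gsum_block_resolvent block_resolvent_carrier by (intro eq_vecI) auto
    then show "v \<in> qmc_L M N B ql lb" by (simp add: qmc_L_def v)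
  qed
qed

lemma lincomb_W_basis:
  assumes r: "r < M*N"
  shows "lincomb (M*N) (N + M) c W_basis $ r = c (r div M) * u (r div M) $ (r mod M) + c (N + r mod M)"
proof -
  have "lincomb (M*N) (N + M) c W_basis $ r = (\<Sum>k<N. if k = r div M then c k * u k $ (r mod M) else 0)
      + (\<Sum>k<M. if k = r mod M then c (N + k) else 0)"
    unfolding lincomb_index[OF r] sum_lessThan_add
    using r by (intro arg_cong2[where f = "(+)"] sum.cong) (auto simp: W_basis_def)
  then show ?thesis using r div_less_N M_pos by simp
qed

lemma qmc_W_span: "qmc_W M N B ql lb = family_span (M*N) (N + M) W_basis"
proof
  show "qmc_W M N B ql lb \<subseteq> family_span (M*N) (N + M) W_basis"
  proof
    fix z assume "z \<in> qmc_W M N B ql lb"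
    then obtain k l where kl: "z = k + l" "k \<in> qmc_K M N B" "l \<in> qmc_L M N B ql lb"
      by (auto simp: qmc_W_def)
    obtain y where y: "y \<in> carrier_vec M" "l = vec (M*N) (\<lambda>r. y $ (r mod M))"
      using kl(3) unfolding qmc_L_diagonal by auto
    have k: "k \<in> carrier_vec (M*N)" using kl by (simp add: qmc_K_def)
    have "\<forall>j. \<exists>c. j < N \<longrightarrow> blk M j k = c \<cdot>\<^sub>v u j"
      using kl(2) ker_B by (auto simp: qmc_K_def blk_def)
    then obtain c where c: "\<And>j. j < N \<Longrightarrow> blk M j k = c j \<cdot>\<^sub>v u j" by metis
    define d where "d i = (if i < N then c i else y $ (i - N))" for i
    have "z = lincomb (M*N) (N + M) d W_basis"
    proof (rule eq_vecI)
      fix r assume "r < dim_vec (lincomb (M*N) (N + M) d W_basis)"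
      then have r: "r < M*N" by simp
      have "k $ r = blk M (r div M) k $ (r mod M)" using M_pos by (simp add: blk_def mult.commute)
      also have "\<dots> = c (r div M) * u (r div M) $ (r mod M)"
        using c[OF div_less_N[OF r]] u_carrier[OF div_less_N[OF r]] M_pos by auto
      finally have "k $ r = c (r div M) * u (r div M) $ (r mod M)" .
      then show "z $ r = lincomb (M*N) (N + M) d W_basis $ r"
        unfolding lincomb_W_basis[OF r] using r y div_less_N[OF r] by (simp add: kl d_def)
    qed (use k y kl in auto)
    then show "z \<in> family_span (M*N) (N + M) W_basis" by (auto simp: family_span_def)
  qed
  show "family_span (M*N) (N + M) W_basis \<subseteq> qmc_W M N B ql lb"
  proof
    fix z assume "z \<in> family_span (M*N) (N + M) W_basis"
    then obtain c where c: "z = lincomb (M*N) (N + M) c W_basis" by (auto simp: family_span_def)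
    define k where "k = vec (M*N) (\<lambda>r. c (r div M) * u (r div M) $ (r mod M))"
    define y where "y = vec M (\<lambda>a. c (N + a))"
    have "z = k + vec (M*N) (\<lambda>r. y $ (r mod M))"
      unfolding c using M_pos by (intro eq_vecI) (auto simp: lincomb_W_basis k_def y_def simp del: lincomb_index)
    moreover have "vec (M*N) (\<lambda>r. y $ (r mod M)) \<in> qmc_L M N B ql lb"
      unfolding qmc_L_diagonal by (auto simp: y_def)
    moreover have "k \<in> qmc_K M N B"
    proof -
      have "B j *\<^sub>v blk M j k = 0\<^sub>v M" if j: "j < N" for j
      proof -
        have "blk M j k = c j \<cdot>\<^sub>v u j"
          using u_carrier[OF j] block_index_less[OF j] by (intro eq_vecI) (auto simp: blk_def k_def)
        then show ?thesis
          using B_u[OF j] mult_mat_vec[OF B_carrier[OF j] u_carrier[OF j]] by (auto intro!: eq_vecI)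
      qed
      then show ?thesis by (simp add: qmc_K_def k_def)
    qed
    ultimately show "z \<in> qmc_W M N B ql lb" by (auto simp: qmc_W_def)
  qed
qed

text \<open>A relation says that the diagonal part \<open>y\<close> equals \<open>- c j\<close>
  times \<open>u j\<close> for every \<open>j\<close>. Hence \<open>y\<close> lies in every kernel
  and vanishes by \<open>ker_inter\<close>, and then each \<open>c j\<close> vanishes since
  \<open>u j\<close> is nonzero. So the sum of \<open>qmc_K\<close> and \<open>qmc_L\<close> is
  direct, of dimension \<open>N + M\<close>.\<close>

lemma indep_W_basis: "indep_family (M*N) (N + M) W_basis"
proof -
  have "c k = 0" if c: "lincomb (M*N) (N + M) c W_basis = 0\<^sub>v (M*N)" and k: "k < N + M" for c k
  proof -
    define y where "y = vec M (\<lambda>a. c (N + a))"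
    have y: "y \<in> carrier_vec M" by (simp add: y_def)
    have e: "c j * u j $ a + y $ a = 0" if "j < N" "a < M" for j a
    proof -
      have "lincomb (M*N) (N + M) c W_basis $ (j*M + a) = 0" using c block_index_less that by simp
      then show ?thesis using lincomb_W_basis[OF block_index_less[OF that]] that by (simp add: y_def)
    qed
    have yj: "y = (- c j) \<cdot>\<^sub>v u j" if j: "j < N" for j
      using e[OF j] u_carrier[OF j] y
      by (intro eq_vecI) (auto simp: add_eq_0_iff[of "c j * _"] simp del: lincomb_index)
    have "B j *\<^sub>v y = 0\<^sub>v M" if j: "j < N" for j
      unfolding yj[OF j] using B_u[OF j] mult_mat_vec[OF B_carrier[OF j] u_carrier[OF j]] by (auto intro!: eq_vecI)
    then have y0: "y = 0\<^sub>v M" using ker_inter[OF y] by blast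
    show ?thesis
    proof (cases "k < N")
      case True
      obtain a where a: "a < M" "u k $ a \<noteq> 0"
        using u_nz[OF True] u_carrier[OF True] by (metis carrier_vecD eq_vecI index_zero_vec)
      then show ?thesis using e[OF True a(1)] y0 by simp
    next
      case False
      then have "k - N < M" using k by simp
      then have "y $ (k - N) = c k" using False by (simp add: y_def)
      then show ?thesis using y0 \<open>k - N < M\<close> by simp
    qed
  qed
  then show ?thesis using W_basis_carrier by (simp add: indep_family_def)
qed

text \<open>The operator here is \<open>I - \<Sum> \<alpha>_j G_j\<close>. On the vectors from the
  kernels \<open>row_value\<close> is zero, which leaves the factor
  \<open>1 - \<alpha> k * lb\<close>; on the diagonal vectors the correction is a multiple of
  \<open>ql * \<beta> + lb = 0\<close>.\<close>

lemma block_resolvent_W_basis: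
  assumes k: "k < N + M"
  shows "block_resolvent M N B (\<lambda>j. 1 - \<alpha> j * lb) (\<lambda>j. \<alpha> j * ql) *\<^sub>v W_basis k
     = (if k < N then 1 - \<alpha> k * lb else 1) \<cdot>\<^sub>v W_basis k"
proof (rule eq_vecI)
  fix r assume "r < dim_vec ((if k < N then 1 - \<alpha> k * lb else 1) \<cdot>\<^sub>v W_basis k)"
  then have r: "r < M*N" using W_basis_carrier[of k] by simp
  have rm: "r mod M < M" using M_pos by simp
  have L: "(block_resolvent M N B (\<lambda>j. 1 - \<alpha> j * lb) (\<lambda>j. \<alpha> j * ql) *\<^sub>v W_basis k) $ r
     = (1 - \<alpha> (r div M) * lb) * W_basis k $ r - \<alpha> (r div M) * ql * row_value (W_basis k) (r mod M)"
    using block_resolvent_mult[OF W_basis_carrier r] by simp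
  show "(block_resolvent M N B (\<lambda>j. 1 - \<alpha> j * lb) (\<lambda>j. \<alpha> j * ql) *\<^sub>v W_basis k) $ r
     = ((if k < N then 1 - \<alpha> k * lb else 1) \<cdot>\<^sub>v W_basis k) $ r"
  proof (cases "k < N")
    case True
    have "(B j *\<^sub>v blk M j (W_basis k)) $ a = 0" if j: "j < N" and a: "a < M" for j a
    proof -
      have "blk M j (W_basis k) = (if j = k then u k else 0\<^sub>v M)"
      proof (rule eq_vecI)
        fix i assume "i < dim_vec (if j = k then u k else 0\<^sub>v M)"
        then have i: "i < M" using carrier_vecD[OF u_carrier[OF True]] by (simp split: if_splits)
        then show "blk M j (W_basis k) $ i = (if j = k then u k else 0\<^sub>v M) $ i"
          using True block_index_less[OF j i] by (simp add: blk_def W_basis_def)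
      qed (use carrier_vecD[OF u_carrier[OF True]] in \<open>auto simp: blk_def\<close>)
      then have "B j *\<^sub>v blk M j (W_basis k) = 0\<^sub>v M" using B_u j B_zero by simp
      then show ?thesis using a by simp
    qed
    then have "row_value (W_basis k) (r mod M) = 0" using row_value_blk[OF rm] rm by simp
    then show ?thesis unfolding L using True r by (simp add: W_basis_def)
  next
    case False
    then have kM: "k - N < M" using k by simp
    have "W_basis k = vec (M*N) (\<lambda>r. unit_vec M (k - N) $ (r mod M))"
      using False kM M_pos by (intro eq_vecI) (auto simp: W_basis_def unit_vec_def)
    then have "row_value (W_basis k) (r mod M) = \<beta> * unit_vec M (k - N) $ (r mod M)"
      using row_value_diagonal[OF unit_vec_carrier rm] by metis
    also have "\<dots> = \<beta> * W_basis k $ r" using False kM r rm by (auto simp: W_basis_def unit_vec_def)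
    finally have "row_value (W_basis k) (r mod M) = \<beta> * W_basis k $ r" .
    then have "(block_resolvent M N B (\<lambda>j. 1 - \<alpha> j * lb) (\<lambda>j. \<alpha> j * ql) *\<^sub>v W_basis k) $ r
       = W_basis k $ r - \<alpha> (r div M) * (ql * \<beta> + lb) * W_basis k $ r"
      unfolding L by (simp add: algebra_simps)
    then show ?thesis using False r W_basis_carrier[of k] by (simp add: ql_lb)
  qed
qed (use W_basis_carrier[of k] block_resolvent_carrier in auto)

lemma quot_basis_qmc:
  assumes "M*N = N + M + d"
  shows "\<exists>v. quot_basis (M*N) (qmc_W M N B ql lb) d v"
  unfolding qmc_W_span using quot_basis_exists[OF indep_W_basis] assms by simp

text \<open>Subtracting \<open>lb\<close> times the identity from the sum of the \<open>G_i\<close>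
  leaves an operator whose image has all blocks equal, hence lies in \<open>qmc_L\<close>. On the
  quotient the sum is therefore the scalar \<open>lb\<close>.\<close>

lemma induced_mat_qmc_Gsum:
  assumes v: "quot_basis (M*N) (qmc_W M N B ql lb) d v"
    and S: "induced_mat (M*N) (qmc_W M N B ql lb) d v (qmc_Gsum M N B ql lb) S"
  shows "S = lb \<cdot>\<^sub>m 1\<^sub>m d"
proof (rule induced_mat_unique[where A = "qmc_Gsum M N B ql lb" and A' = "lb \<cdot>\<^sub>m 1\<^sub>m (M*N)"])
  show v': "quot_basis (M*N) (family_span (M*N) (N + M) W_basis) d v" using v by (simp add: qmc_W_span)
  show "induced_mat (M*N) (family_span (M*N) (N + M) W_basis) d v (qmc_Gsum M N B ql lb) S"
    using S by (simp add: qmc_W_span)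
  show "induced_mat (M*N) (family_span (M*N) (N + M) W_basis) d v (lb \<cdot>\<^sub>m 1\<^sub>m (M*N)) (lb \<cdot>\<^sub>m 1\<^sub>m d)"
    by (intro induced_mat_smult induced_mat_one v') auto
  show "qmc_Gsum M N B ql lb \<in> carrier_mat (M*N) (M*N)"
    by (simp add: qmc_Gsum_block_resolvent block_resolvent_carrier)
  fix j assume j: "j < d"
  have vj: "v j \<in> carrier_vec (M*N)" using v j by (simp add: quot_basis_def)
  define y where "y = vec M (\<lambda>a. ql * row_value (v j) a)"
  have "qmc_Gsum M N B ql lb *\<^sub>v v j - (lb \<cdot>\<^sub>m 1\<^sub>m (M*N)) *\<^sub>v v j = vec (M*N) (\<lambda>r. y $ (r mod M))"
    unfolding qmc_Gsum_block_resolvent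
  proof (rule eq_vecI)
    fix r assume "r < dim_vec (vec (M*N) (\<lambda>r. y $ (r mod M)))"
    then have r: "r < M*N" by simp
    have "((lb \<cdot>\<^sub>m 1\<^sub>m (M*N)) *\<^sub>v v j) $ r = lb * v j $ r"
      using vj r by simp
    then show "(block_resolvent M N B (\<lambda>_. lb) (\<lambda>_. - ql) *\<^sub>v v j - (lb \<cdot>\<^sub>m 1\<^sub>m (M*N)) *\<^sub>v v j) $ r
        = vec (M*N) (\<lambda>r. y $ (r mod M)) $ r"
      using r M_pos block_resolvent_mult[OF vj r] by (simp add: y_def)
  qed simp
  also have "\<dots> \<in> qmc_L M N B ql lb" unfolding qmc_L_diagonal by (auto simp: y_def)
  also have "\<dots> \<subseteq> qmc_W M N B ql lb"
  proof
    fix l assume l: "l \<in> qmc_L M N B ql lb"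
    have "0\<^sub>v (M*N) \<in> qmc_K M N B"
    proof -
      have "blk M j (0\<^sub>v (M*N)) = 0\<^sub>v M" if "j < N" for j
        using that block_index_less by (intro eq_vecI) (auto simp: blk_def)
      then show ?thesis by (simp add: qmc_K_def B_zero)
    qed
    moreover have "l = 0\<^sub>v (M*N) + l" using l by (simp add: qmc_L_def)
    ultimately show "l \<in> qmc_W M N B ql lb" using l unfolding qmc_W_def by blast
  qed
  finally show "qmc_Gsum M N B ql lb *\<^sub>v v j - (lb \<cdot>\<^sub>m 1\<^sub>m (M*N)) *\<^sub>v v j \<in> family_span (M*N) (N + M) W_basis"
    by (simp add: qmc_W_span)
qed auto

text \<open>The determinant on the whole space is evaluated twice: as the eigenvalues on the
  subspace times \<open>det R\<close>, and by the matrix determinant lemma. The eigenvalues cancel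
  one of the \<open>M\<close> copies of the product, which explains the exponent
  \<open>M - 1\<close>.\<close>

lemma det_induced_block_resolvent:
  assumes v: "quot_basis (M*N) (qmc_W M N B ql lb) d v" and d: "M*N = N + M + d"
    and nz: "\<And>j. j < N \<Longrightarrow> 1 - \<alpha> j * lb \<noteq> 0"
    and R: "induced_mat (M*N) (qmc_W M N B ql lb) d v
        (block_resolvent M N B (\<lambda>j. 1 - \<alpha> j * lb) (\<lambda>j. \<alpha> j * ql)) R"
  shows "det R = (\<Prod>j<N. 1 - \<alpha> j * lb) ^ (M - 1)
      * det (1\<^sub>m M - mat M M (\<lambda>(a,b). \<Sum>j<N. \<alpha> j * ql / (1 - \<alpha> j * lb) * B j $$ (a,b)))" (is "_ = _ * ?D")
proof -
  let ?p = "\<Prod>j<N. 1 - \<alpha> j * lb"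
  have "det (block_resolvent M N B (\<lambda>j. 1 - \<alpha> j * lb) (\<lambda>j. \<alpha> j * ql))
      = (\<Prod>k<N + M. if k < N then 1 - \<alpha> k * lb else 1) * det R"
    using v R unfolding qmc_W_span
    by (intro induced_mat_det[OF indep_W_basis _ d block_resolvent_carrier]) (auto simp: block_resolvent_W_basis)
  also have "(\<Prod>k<N + M. if k < N then 1 - \<alpha> k * lb else 1) = ?p"
    by (rule prod.mono_neutral_cong_right) auto
  finally have "?p * det R = ?p ^ M * ?D"
    using det_block_resolvent[OF M_pos nz] by simp
  moreover have "?p ^ M = ?p * ?p ^ (M - 1)" using M_pos by (simp add: power_eq_if)
  moreover have "?p \<noteq> 0" using nz by simp
  ultimately show ?thesis by (simp add: mult.assoc)
qed

end

section \<open>Polynomial matrices and simple zeros of their determinants\<close>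

text \<open>Identities derived from rational expressions are available only away from the poles;
  this extends them to all arguments.\<close>

lemma poly_eq_off_finite:
  fixes p q :: "complex poly"
  assumes "finite S" and "\<And>x. x \<notin> S \<Longrightarrow> poly p x = poly q x"
  shows "p = q"
proof (rule ccontr)
  assume "p \<noteq> q"
  then have "finite {x. poly (p - q) x = 0}" by (intro poly_roots_finite) simp
  then have "finite ({x. poly (p - q) x = 0} \<union> S)" using assms(1) by simp
  moreover have "{x. poly (p - q) x = 0} \<union> S = UNIV" using assms(2) by auto
  ultimately show False using infinite_UNIV_char_0[where 'a = complex] by metis
qed

text \<open>Evaluation at a point is a ring homomorphism and commutes with \<open>det\<close>. The
  determinant of a matrix of polynomials can thus be treated as one polynomial whose zeros have
  multiplicities.\<close>

lemma det_poly_mat: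
  "det (mat n n (\<lambda>(i,j). poly (F i j) x)) = poly (det (mat n n (\<lambda>(i,j). F i j))) (x :: complex)"
proof -
  interpret comm_ring_hom "\<lambda>p. poly p x" by unfold_locales auto
  have "mat n n (\<lambda>(i,j). poly (F i j) x) = map_mat (\<lambda>p. poly p x) (mat n n (\<lambda>(i,j). F i j))"
    by (rule eq_matI) auto
  then show ?thesis by (simp only: hom_det)
qed

lemma det_const_poly_mat:
  "det (mat n n (\<lambda>(i,j). [:c i j:])) = [:det (mat n n (\<lambda>(i,j). c i j)) :: complex:]"
proof -
  interpret comm_ring_hom "\<lambda>c::complex. [:c:]"
    by unfold_locales (auto simp: one_pCons)
  have "mat n n (\<lambda>(i,j). [:c i j:]) = map_mat (\<lambda>c. [:c:]) (mat n n (\<lambda>(i,j). c i j))"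
    by (rule eq_matI) auto
  then show ?thesis by (simp only: hom_det)
qed

text \<open>Two independent kernel vectors at \<open>t\<close>, taken as the first columns of a constant change of
  basis, would make two columns divisible by \<open>x - t\<close>.\<close>

lemma simple_zero_det_kernel:
  fixes F :: "nat \<Rightarrow> nat \<Rightarrow> complex poly" and t :: complex and n :: nat
  defines "A \<equiv> mat n n (\<lambda>(i,j). poly (F i j) t)"
  assumes n: "2 \<le> n"
    and simple: "\<not> [:- t, 1:]^2 dvd det (mat n n (\<lambda>(i,j). F i j))"
    and u: "u \<in> carrier_vec n" "u \<noteq> 0\<^sub>v n" "A *\<^sub>v u = 0\<^sub>v n"
    and y: "y \<in> carrier_vec n" "A *\<^sub>v y = 0\<^sub>v n"
  shows "\<exists>c. y = c \<cdot>\<^sub>v u"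
proof (rule ccontr)
  assume no: "\<nexists>c. y = c \<cdot>\<^sub>v u"
  define w where "w k = (if k = 0 then u else y)" for k :: nat
  have "c k = 0" if c: "lincomb n 2 c w = 0\<^sub>v n" and k: "k < 2" for c k
  proof -
    have e: "c 0 * u $ r + c 1 * y $ r = 0" if "r < n" for r
    proof -
      have "lincomb n 2 c w $ r = 0" using c that by simp
      then show ?thesis using that by (simp add: w_def numeral_2_eq_2)
    qed
    have c1: "c 1 = 0"
    proof (rule ccontr)
      assume nz: "c 1 \<noteq> 0"
      have "y = (- c 0 / c 1) \<cdot>\<^sub>v u"
      proof (rule eq_vecI)
        fix r assume "r < dim_vec ((- c 0 / c 1) \<cdot>\<^sub>v u)"
        then have "r < n" using u by simp
        then show "y $ r = ((- c 0 / c 1) \<cdot>\<^sub>v u) $ r" using e[of r] nz u(1)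
          by (simp add: field_simps eq_neg_iff_add_eq_0)
      qed (use u y in auto)
      then show False using no by blast
    qed
    obtain a where "a < n" "u $ a \<noteq> 0" using u by (metis carrier_vecD eq_vecI index_zero_vec)
    then have "c 0 = 0" using e[of a] c1 by simp
    then show ?thesis using c1 k by (auto simp: less_2_cases_iff)
  qed
  then have "indep_family n 2 w" using u y by (simp add: indep_family_def w_def)
  then obtain z where z: "indep_family n n z" "\<forall>k<2. z k = w k" using indep_family_extend n by blast
  let ?l = "[:- t, 1:]"
  let ?P = "mat n n (\<lambda>(i,j). F i j)" and ?Z = "mat n n (\<lambda>(i,k). [:z k $ i:])"
  define E where "E i k = (\<Sum>j = 0..<n. F i j * [:z k $ j:])" for i k
  define H where "H i k = (if k < 2 then E i k div ?l else E i k)" for i k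
  have E0: "poly (E i k) t = 0" if "i < n" "k < 2" for i k
  proof -
    have "z k \<in> carrier_vec n" using z u y that by (auto simp: w_def)
    then have "poly (E i k) t = (A *\<^sub>v z k) $ i"
      using that by (auto simp: E_def A_def scalar_prod_def poly_sum intro!: sum.cong)
    also have "A *\<^sub>v z k = 0\<^sub>v n" using z(2) that u y by (auto simp: w_def)
    finally show ?thesis using that by simp
  qed
  define \<Delta> where "\<Delta> = mat_diag n (\<lambda>k. if k < 2 then ?l else 1)"
  have "?P * ?Z = mat n n (\<lambda>(i,k). H i k) * \<Delta>"
  proof -
    have "E i k = H i k * (if k < 2 then ?l else 1)" if "i < n" "k < n" for i k
    proof (cases "k < 2")
      case True
      then have "?l dvd E i k" using E0[OF that(1)] by (simp add: poly_eq_0_iff_dvd)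
      then have "E i k div ?l * ?l = E i k" by (rule dvd_div_mult_self)
      then show ?thesis using True by (simp only: H_def if_True)
    qed (simp add: H_def)
    moreover have "mat n n (\<lambda>(i,k). H i k) * \<Delta> = mat n n (\<lambda>(i,k). mat n n (\<lambda>(i,k). H i k) $$ (i,k) * (if k < 2 then ?l else 1))"
      unfolding \<Delta>_def by (rule mat_diag_mult_right) auto
    ultimately show ?thesis
      by (intro eq_matI) (auto simp: scalar_prod_def E_def)
  qed
  then have "det ?P * det ?Z = det (mat n n (\<lambda>(i,k). H i k)) * det \<Delta>"
    using det_mult[of ?P n ?Z] det_mult[of "mat n n (\<lambda>(i,k). H i k)" n \<Delta>] by (simp add: \<Delta>_def)
  moreover have "det \<Delta> = ?l^2"
  proof -
    have "det \<Delta> = (\<Prod>k<n. if k < 2 then ?l else 1)"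
      unfolding \<Delta>_def by (rule det_mat_diag)
    also have "\<dots> = (\<Prod>k<2::nat. ?l)"
      using n by (intro prod.mono_neutral_cong_right) auto
    finally show ?thesis by simp
  qed
  moreover have "det ?Z = [:det (colmat n n z):]" by (simp add: det_const_poly_mat colmat_def)
  \<comment> \<open>The matrix \<open>?Z\<close> is constant and invertible, so its determinant is a
    nonzero number and does not affect divisibility by the square.\<close>
  ultimately have "?l^2 dvd smult (det (colmat n n z)) (det ?P)"
    by (metis dvd_triv_right mult_pCons_right mult_zero_right pCons_0_0 add_0_right)
  then show False using simple indep_family_det[OF z(1)] by (simp add: dvd_smult_iff)
qed

section \<open>Partial fractions and coefficients of a cubic pencil\<close>

text \<open>These are the coefficients of one entry of the pencil, with \<open>\<delta>\<close> the
  entry of the identity and the \<open>b\<close>'s those of the residues. The leading coefficient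
  involves the residues only through their sum.\<close>

lemma pencil_expand:
  fixes e\<^sub>1 e\<^sub>2 e\<^sub>3 x h \<delta> b\<^sub>1 b\<^sub>2 b\<^sub>3 :: complex
  assumes "e\<^sub>1 \<noteq> 0" "e\<^sub>2 \<noteq> 0" "e\<^sub>3 \<noteq> 0"
  shows "(1 + x/e\<^sub>1) * (1 + x/e\<^sub>2) * (1 + x/e\<^sub>3) * \<delta> - h * x *
      (b\<^sub>1 / e\<^sub>1 * (1 + x/e\<^sub>2) * (1 + x/e\<^sub>3) + b\<^sub>2 / e\<^sub>2 * (1 + x/e\<^sub>1) * (1 + x/e\<^sub>3) + b\<^sub>3 / e\<^sub>3 * (1 + x/e\<^sub>1) * (1 + x/e\<^sub>2))
    = \<delta> + x * (\<delta> * (1/e\<^sub>1 + 1/e\<^sub>2 + 1/e\<^sub>3) - h * (b\<^sub>1/e\<^sub>1 + b\<^sub>2/e\<^sub>2 + b\<^sub>3/e\<^sub>3))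
      + x^2 * (\<delta> * (1/(e\<^sub>1*e\<^sub>2) + 1/(e\<^sub>1*e\<^sub>3) + 1/(e\<^sub>2*e\<^sub>3))
          - h * (b\<^sub>1/e\<^sub>1 * (1/e\<^sub>2 + 1/e\<^sub>3) + b\<^sub>2/e\<^sub>2 * (1/e\<^sub>1 + 1/e\<^sub>3) + b\<^sub>3/e\<^sub>3 * (1/e\<^sub>1 + 1/e\<^sub>2)))
      + x^3 * ((\<delta> - h * (b\<^sub>1 + b\<^sub>2 + b\<^sub>3)) / (e\<^sub>1*e\<^sub>2*e\<^sub>3))"
proof -
  \<comment> \<open>With the reciprocals named, the claim becomes a polynomial identity.\<close>
  define i\<^sub>1 i\<^sub>2 i\<^sub>3 where i: "i\<^sub>1 = 1/e\<^sub>1" "i\<^sub>2 = 1/e\<^sub>2" "i\<^sub>3 = 1/e\<^sub>3"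
  have d: "y / e\<^sub>1 = y * i\<^sub>1" "y / e\<^sub>2 = y * i\<^sub>2" "y / e\<^sub>3 = y * i\<^sub>3" "y / (e\<^sub>1*e\<^sub>2) = y * i\<^sub>1 * i\<^sub>2"
     "y / (e\<^sub>1*e\<^sub>3) = y * i\<^sub>1 * i\<^sub>3" "y / (e\<^sub>2*e\<^sub>3) = y * i\<^sub>2 * i\<^sub>3" "y / (e\<^sub>1*e\<^sub>2*e\<^sub>3) = y * i\<^sub>1 * i\<^sub>2 * i\<^sub>3" for y
    by (simp_all add: i)
  show ?thesis unfolding d by (simp add: algebra_simps power2_eq_square power3_eq_cube)
qed

text \<open>Each pole cancels against its own linear factor,
  \<open>(1 + x/e) * (b / (x + e)) = b / e\<close>.\<close>

lemma pencil_clear_denominators: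
  fixes e\<^sub>1 e\<^sub>2 e\<^sub>3 x h \<delta> b\<^sub>1 b\<^sub>2 b\<^sub>3 :: complex
  assumes "e\<^sub>1 \<noteq> 0" "e\<^sub>2 \<noteq> 0" "e\<^sub>3 \<noteq> 0" "x \<noteq> - e\<^sub>1" "x \<noteq> - e\<^sub>2" "x \<noteq> - e\<^sub>3"
  shows "(1 + x/e\<^sub>1) * (1 + x/e\<^sub>2) * (1 + x/e\<^sub>3) * (\<delta> - h * x * (b\<^sub>1 / (x + e\<^sub>1) + b\<^sub>2 / (x + e\<^sub>2) + b\<^sub>3 / (x + e\<^sub>3)))
    = (1 + x/e\<^sub>1) * (1 + x/e\<^sub>2) * (1 + x/e\<^sub>3) * \<delta> - h * x *
      (b\<^sub>1 / e\<^sub>1 * (1 + x/e\<^sub>2) * (1 + x/e\<^sub>3) + b\<^sub>2 / e\<^sub>2 * (1 + x/e\<^sub>1) * (1 + x/e\<^sub>3) + b\<^sub>3 / e\<^sub>3 * (1 + x/e\<^sub>1) * (1 + x/e\<^sub>2))"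
proof -
  have r: "(1 + x/e) * (b / (x + e)) = b / e" if "e \<noteq> 0" "x \<noteq> - e" for e b
  proof -
    have "x + e \<noteq> 0" using that by (simp add: add_eq_0_iff2)
    moreover have "1 + x/e = (x + e) / e" using that by (simp add: add_divide_distrib add.commute)
    ultimately show ?thesis by simp
  qed
  define p\<^sub>1 p\<^sub>2 p\<^sub>3 where p: "p\<^sub>1 = 1 + x/e\<^sub>1" "p\<^sub>2 = 1 + x/e\<^sub>2" "p\<^sub>3 = 1 + x/e\<^sub>3"
  have q: "b\<^sub>1/e\<^sub>1 = p\<^sub>1 * (b\<^sub>1 / (x + e\<^sub>1))" "b\<^sub>2/e\<^sub>2 = p\<^sub>2 * (b\<^sub>2 / (x + e\<^sub>2))" "b\<^sub>3/e\<^sub>3 = p\<^sub>3 * (b\<^sub>3 / (x + e\<^sub>3))"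
    using r assms by (simp_all add: p)
  show ?thesis unfolding p[symmetric] q by (simp only: algebra_simps)
qed

lemma sum_lessThan_3: "(\<Sum>j<3. f j) = f 0 + f 1 + f (2::nat)" for f :: "nat \<Rightarrow> 'a::comm_monoid_add"
  by (simp add: eval_nat_numeral)

lemma prod_lessThan_3: "(\<Prod>j<3. f j) = f 0 * f 1 * f (2::nat)" for f :: "nat \<Rightarrow> 'a::comm_monoid_mult"
  by (simp add: eval_nat_numeral)

lemma prod_1_9: "(\<Prod>i=1..9. f i) = f 1 * f 2 * f 3 * (\<Prod>i=4..9. f (i::nat))" for f :: "nat \<Rightarrow> 'a::comm_monoid_mult"
proof -
  have "{1..9::nat} = insert 1 (insert 2 (insert 3 {4..9}))" by auto
  then show ?thesis by (simp add: mult.assoc)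
qed

text \<open>After one factor is cancelled, a second one would make \<open>- e i\<close> a root of
  the remaining product, against the injectivity of \<open>e\<close>.\<close>

lemma linear_factor_prod_simple:
  fixes e :: "nat \<Rightarrow> complex"
  assumes "inj_on e I" "finite I" "i \<in> I" "k \<noteq> 0"
    and D: "\<And>x. poly D x = k * (\<Prod>j\<in>I. x + e j)"
  shows "\<not> [:e i, 1:]^2 dvd D"
proof
  let ?l = "[:e i, 1:]"
  let ?R = "smult k (\<Prod>j\<in>I - {i}. [:e j, 1:])"
  assume "?l^2 dvd D"
  then obtain r where "D = ?l^2 * r" by (elim dvdE)
  then have "D = ?l * (?l * r)" by (simp only: power2_eq_square mult.assoc)
  moreover have "D = ?l * ?R"
  proof (rule poly_eq_off_finite[of "{}"])
    fix x
    show "poly D x = poly (?l * ?R) x"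
      using assms(2,3) by (simp add: D prod.remove poly_prod algebra_simps)
  qed simp
  ultimately have "?R = ?l * r" using mult_cancel_left[of ?l ?R "?l * r"] by simp
  then have "poly ?R (- e i) = 0" by simp
  then have "\<exists>j\<in>I - {i}. e j = e i" using assms(2,4) by (auto simp: poly_prod)
  then show False using assms(1,3) by (auto simp: inj_on_def)
qed

theorem mainTheorem5:
  fixes q \<kappa> :: complex and e :: "nat \<Rightarrow> complex"
    and A1 A2 :: "complex mat" and Ai :: "nat \<Rightarrow> complex mat"
  assumes q: "0 < norm q" "norm q < 1"
    and \<kappa>0: "\<kappa> \<noteq> 0"
    and e0: "\<forall>i\<in>{1..9}. e i \<noteq> 0"
    and edist: "inj_on e {1..9}"
    and prod1: "\<kappa>^3 * (\<Prod>i=1..9. e i) = 1"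
    and A1c: "A1 \<in> carrier_mat 3 3" and A2c: "A2 \<in> carrier_mat 3 3"
    and detA: "\<forall>x. det (1\<^sub>m 3 + x \<cdot>\<^sub>m A1 + x^2 \<cdot>\<^sub>m A2 + (\<kappa> * x^3) \<cdot>\<^sub>m 1\<^sub>m 3)
                    = \<kappa>^3 * (\<Prod>i=1..9. x + e i)"
    and Aic: "\<forall>i\<in>{1,2,3}. Ai i \<in> carrier_mat 3 3"
    and Aidef: "\<forall>x. x \<noteq> 0 \<and> x \<noteq> - e 1 \<and> x \<noteq> - e 2 \<and> x \<noteq> - e 3 \<longrightarrow>
        (1 / (x + e 1)) \<cdot>\<^sub>m Ai 1 + (1 / (x + e 2)) \<cdot>\<^sub>m Ai 2 + (1 / (x + e 3)) \<cdot>\<^sub>m Ai 3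
        = (1 / ((1 - q) * x)) \<cdot>\<^sub>m (1\<^sub>m 3 - (1 / ((1 + x / e 1) * (1 + x / e 2) * (1 + x / e 3)))
              \<cdot>\<^sub>m (1\<^sub>m 3 + x \<cdot>\<^sub>m A1 + x^2 \<cdot>\<^sub>m A2 + (\<kappa> * x^3) \<cdot>\<^sub>m 1\<^sub>m 3))"
    and gen: "\<kappa> * e 1 * e 2 * e 3 \<noteq> 1"
    and kerint: "\<forall>v\<in>carrier_vec 3. Ai 1 *\<^sub>v v = 0\<^sub>v 3 \<and> Ai 2 *\<^sub>v v = 0\<^sub>v 3 \<and> Ai 3 *\<^sub>v v = 0\<^sub>v 3
                   \<longrightarrow> v = 0\<^sub>v 3"
  shows "(\<exists>v. quot_basis 9
              (qmc_W 3 3 (\<lambda>j. Ai (Suc j)) (1 / (\<kappa> * e 1 * e 2 * e 3))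
                 ((1 - 1 / (\<kappa> * e 1 * e 2 * e 3)) / (1 - q))) 3 v)
    \<and> (\<forall>v Gb. quot_basis 9
              (qmc_W 3 3 (\<lambda>j. Ai (Suc j)) (1 / (\<kappa> * e 1 * e 2 * e 3))
                 ((1 - 1 / (\<kappa> * e 1 * e 2 * e 3)) / (1 - q))) 3 v
          \<and> (\<forall>i\<in>{1,2,3}. induced_mat 9
              (qmc_W 3 3 (\<lambda>j. Ai (Suc j)) (1 / (\<kappa> * e 1 * e 2 * e 3))
                 ((1 - 1 / (\<kappa> * e 1 * e 2 * e 3)) / (1 - q))) 3 v
              (qmc_G 3 3 (\<lambda>j. Ai (Suc j)) (1 / (\<kappa> * e 1 * e 2 * e 3))
                 ((1 - 1 / (\<kappa> * e 1 * e 2 * e 3)) / (1 - q)) (i - 1))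
              (Gb i))
        \<longrightarrow> (let \<kappa>t = 1 / (\<kappa> * (e 1 * e 2 * e 3)^2);
                 et = (\<lambda>i. if i \<le> 3 then e i else \<kappa> * e 1 * e 2 * e 3 * e i)
             in \<exists>At1 At2. At1 \<in> carrier_mat 3 3 \<and> At2 \<in> carrier_mat 3 3 \<and>
                (\<forall>x. x \<noteq> - e 1 \<and> x \<noteq> - e 2 \<and> x \<noteq> - e 3 \<longrightarrow>
                   ((1 + x / e 1) * (1 + x / e 2) * (1 + x / e 3)) \<cdot>\<^sub>m
                     (1\<^sub>m 3 - ((1 - q) * x) \<cdot>\<^sub>m
                        ((1 / (x + e 1)) \<cdot>\<^sub>m Gb 1 + (1 / (x + e 2)) \<cdot>\<^sub>m Gb 2
                          + (1 / (x + e 3)) \<cdot>\<^sub>m Gb 3))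
                   = 1\<^sub>m 3 + x \<cdot>\<^sub>m At1 + x^2 \<cdot>\<^sub>m At2 + (\<kappa>t * x^3) \<cdot>\<^sub>m 1\<^sub>m 3) \<and>
                (\<forall>x. det (1\<^sub>m 3 + x \<cdot>\<^sub>m At1 + x^2 \<cdot>\<^sub>m At2 + (\<kappa>t * x^3) \<cdot>\<^sub>m 1\<^sub>m 3)
                     = \<kappa>t^3 * (\<Prod>i=1..9. x + et i))))"
proof -
  \<comment> \<open>Here \<open>s\<close> is the inverse of \<open>q^lambda\<close>,
    \<open>h\<close> is \<open>1 - q\<close>, and \<open>B\<close> passes to indices starting at
    0.\<close>
  define s where "s = \<kappa> * e 1 * e 2 * e 3"
  define h where "h = 1 - q"
  define ql where "ql = 1 / s"
  define lb where "lb = (1 - 1 / s) / h"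
  define B where "B = (\<lambda>j. Ai (Suc j))"
  define \<delta> where "\<delta> a b = (if a = b then 1 else 0 :: complex)" for a b :: nat
  define p where "p x = (1 + x / e 1) * (1 + x / e 2) * (1 + x / e 3)" for x
  have h0: "h \<noteq> 0" using q by (auto simp: h_def)
  have e123: "e 1 \<noteq> 0" "e 2 \<noteq> 0" "e 3 \<noteq> 0" using e0 by auto
  have s0: "s \<noteq> 0" "s \<noteq> 1" using gen \<kappa>0 e123 by (auto simp: s_def)
  have dist: "e 1 \<noteq> e 2" "e 1 \<noteq> e 3" "e 2 \<noteq> e 3"
    using inj_onD[OF edist, of 1 2] inj_onD[OF edist, of 1 3] inj_onD[OF edist, of 2 3] by auto
  have Ac: "Ai 1 \<in> carrier_mat 3 3" "Ai 2 \<in> carrier_mat 3 3" "Ai 3 \<in> carrier_mat 3 3"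
    using Aic by auto
  have lb0: "lb \<noteq> 0" using s0 h0 by (simp add: lb_def field_simps)
  have B012: "B 0 = Ai 1" "B 1 = Ai 2" "B 2 = Ai 3"
    by (simp_all add: B_def numeral_2_eq_2 numeral_3_eq_3)
  have less3: "j = 0 \<or> j = 1 \<or> j = 2" if "j < 3" for j :: nat using that by auto
  have Bc: "B j \<in> carrier_mat 3 3" if "j < 3" for j
    using less3[OF that] Ac B012 by auto
  have p0: "p x \<noteq> 0" if "x \<noteq> - e 1" "x \<noteq> - e 2" "x \<noteq> - e 3" for x
  proof -
    have "1 + x / c \<noteq> 0" if "c \<noteq> 0" "x \<noteq> - c" for c
      using that by (auto simp: add_eq_0_iff minus_divide_left divide_eq_eq)
    then show ?thesis using that e123 by (simp add: p_def)
  qed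

  \<comment> \<open>The given pencil and its residues\<close>
  define A where "A x = 1\<^sub>m 3 + x \<cdot>\<^sub>m A1 + x^2 \<cdot>\<^sub>m A2 + (\<kappa> * x^3) \<cdot>\<^sub>m 1\<^sub>m 3" for x
  define P where "P a b = [:\<delta> a b, A1 $$ (a,b), A2 $$ (a,b), \<kappa> * \<delta> a b:]" for a b
  have A_poly: "A x = mat 3 3 (\<lambda>(a,b). poly (P a b) x)" for x
    using A1c A2c
    by (intro eq_matI) (auto simp: A_def P_def \<delta>_def algebra_simps power2_eq_square power3_eq_cube)
  have detA': "det (A x) = \<kappa>^3 * (\<Prod>i=1..9. x + e i)" for x
    using detA by (simp add: A_def)

  \<comment> \<open>\<open>C\<^sub>1\<close>, \<open>C\<^sub>2\<close> and \<open>C\<^sub>3\<close>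
    are the coefficients from \<open>pencil_expand\<close>. They are kept as functions of the
    residue entries because they are used both for \<open>Ai\<close> and for
    \<open>Gb\<close>.\<close>
  define C\<^sub>1 where "C\<^sub>1 d b\<^sub>1 b\<^sub>2 b\<^sub>3 = d * (1/e 1 + 1/e 2 + 1/e 3) - h * (b\<^sub>1/e 1 + b\<^sub>2/e 2 + b\<^sub>3/e 3)" for d b\<^sub>1 b\<^sub>2 b\<^sub>3
  define C\<^sub>2 where "C\<^sub>2 d b\<^sub>1 b\<^sub>2 b\<^sub>3 = d * (1/(e 1*e 2) + 1/(e 1*e 3) + 1/(e 2*e 3))
          - h * (b\<^sub>1/e 1 * (1/e 2 + 1/e 3) + b\<^sub>2/e 2 * (1/e 1 + 1/e 3) + b\<^sub>3/e 3 * (1/e 1 + 1/e 2))" for d b\<^sub>1 b\<^sub>2 b\<^sub>3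
  define C\<^sub>3 where "C\<^sub>3 d b\<^sub>1 b\<^sub>2 b\<^sub>3 = (d - h * (b\<^sub>1 + b\<^sub>2 + b\<^sub>3)) / (e 1*e 2*e 3)" for d b\<^sub>1 b\<^sub>2 b\<^sub>3
  have expand: "poly [:d, C\<^sub>1 d b\<^sub>1 b\<^sub>2 b\<^sub>3, C\<^sub>2 d b\<^sub>1 b\<^sub>2 b\<^sub>3, C\<^sub>3 d b\<^sub>1 b\<^sub>2 b\<^sub>3:] x = p x * d - h * x *
      (b\<^sub>1 / e 1 * (1 + x/e 2) * (1 + x/e 3) + b\<^sub>2 / e 2 * (1 + x/e 1) * (1 + x/e 3) + b\<^sub>3 / e 3 * (1 + x/e 1) * (1 + x/e 2))"
    for d b\<^sub>1 b\<^sub>2 b\<^sub>3 x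
    unfolding p_def pencil_expand[OF e123, of x d h b\<^sub>1 b\<^sub>2 b\<^sub>3]
      C\<^sub>1_def[symmetric] C\<^sub>2_def[symmetric] C\<^sub>3_def[symmetric]
    by (simp add: algebra_simps power2_eq_square power3_eq_cube)
  have clear: "p x * (d - h * x * (b\<^sub>1 / (x + e 1) + b\<^sub>2 / (x + e 2) + b\<^sub>3 / (x + e 3)))
      = poly [:d, C\<^sub>1 d b\<^sub>1 b\<^sub>2 b\<^sub>3, C\<^sub>2 d b\<^sub>1 b\<^sub>2 b\<^sub>3, C\<^sub>3 d b\<^sub>1 b\<^sub>2 b\<^sub>3:] x"
    if "x \<noteq> - e 1" "x \<noteq> - e 2" "x \<noteq> - e 3" for d b\<^sub>1 b\<^sub>2 b\<^sub>3 x
    unfolding expand unfolding p_def by (rule pencil_clear_denominators[OF e123 that])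

  \<comment> \<open>The definition of the \<open>Ai\<close> gives this equality of cubics outside
    four points, hence as polynomials. Its coefficient of \<open>x^3\<close> will yield the sum of
    the residues.\<close>
  have PC: "P a b = [:\<delta> a b, C\<^sub>1 (\<delta> a b) (Ai 1 $$ (a,b)) (Ai 2 $$ (a,b)) (Ai 3 $$ (a,b)),
      C\<^sub>2 (\<delta> a b) (Ai 1 $$ (a,b)) (Ai 2 $$ (a,b)) (Ai 3 $$ (a,b)),
      C\<^sub>3 (\<delta> a b) (Ai 1 $$ (a,b)) (Ai 2 $$ (a,b)) (Ai 3 $$ (a,b)):]" (is "_ = ?Q")
    if ab: "a < 3" "b < 3" for a b
  proof (rule poly_eq_off_finite[of "{0, - e 1, - e 2, - e 3}"])
    fix x assume "x \<notin> {0, - e 1, - e 2, - e 3}"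
    then have x: "x \<noteq> 0" "x \<noteq> - e 1" "x \<noteq> - e 2" "x \<noteq> - e 3" by auto
    let ?F = "Ai 1 $$ (a,b) / (x + e 1) + Ai 2 $$ (a,b) / (x + e 2) + Ai 3 $$ (a,b) / (x + e 3)"
    have "(1 / (x + e 1)) \<cdot>\<^sub>m Ai 1 + (1 / (x + e 2)) \<cdot>\<^sub>m Ai 2 + (1 / (x + e 3)) \<cdot>\<^sub>m Ai 3
        = (1 / (h * x)) \<cdot>\<^sub>m (1\<^sub>m 3 - (1 / p x) \<cdot>\<^sub>m A x)" (is "?L = ?R")
      using Aidef x by (simp add: h_def p_def A_def)
    then have "?L $$ (a,b) = ?R $$ (a,b)" by simp
    moreover have "?L $$ (a,b) = ?F" using ab Ac by simp
    moreover have "?R $$ (a,b) = 1 / (h * x) * (\<delta> a b - 1 / p x * poly (P a b) x)"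
      using ab by (simp add: A_poly \<delta>_def)
    ultimately have F: "?F = 1 / (h * x) * (\<delta> a b - 1 / p x * poly (P a b) x)" by metis
    have "h * x * ?F = \<delta> a b - poly (P a b) x / p x" unfolding F using x h0 by simp
    then have "poly (P a b) x = p x * (\<delta> a b - h * x * ?F)" using p0[OF x(2-4)] by simp
    then show "poly (P a b) x = poly ?Q x" using clear[OF x(2-4)] by simp
  qed simp

  \<comment> \<open>With denominators cleared, the formula may also be evaluated at the points
    \<open>- e i\<close>.\<close>
  have A_entry: "poly (P a b) x = p x * \<delta> a b - h * x *
      (Ai 1 $$ (a,b) / e 1 * (1 + x/e 2) * (1 + x/e 3) + Ai 2 $$ (a,b) / e 2 * (1 + x/e 1) * (1 + x/e 3)
        + Ai 3 $$ (a,b) / e 3 * (1 + x/e 1) * (1 + x/e 2))" if "a < 3" "b < 3" for a b x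
    unfolding PC[OF that] expand ..
  have A_generic: "A x = p x \<cdot>\<^sub>m (1\<^sub>m 3 - mat 3 3 (\<lambda>(a,b). h * x *
      (Ai 1 $$ (a,b) / (x + e 1) + Ai 2 $$ (a,b) / (x + e 2) + Ai 3 $$ (a,b) / (x + e 3))))"
    if "x \<noteq> - e 1" "x \<noteq> - e 2" "x \<noteq> - e 3" for x
    unfolding A_poly
  proof (rule eq_matI)
    fix a b assume "a < dim_row (p x \<cdot>\<^sub>m (1\<^sub>m 3 - mat 3 3 (\<lambda>(a,b). h * x *
      (Ai 1 $$ (a,b) / (x + e 1) + Ai 2 $$ (a,b) / (x + e 2) + Ai 3 $$ (a,b) / (x + e 3)))))"
      "b < dim_col (p x \<cdot>\<^sub>m (1\<^sub>m 3 - mat 3 3 (\<lambda>(a,b). h * x *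
      (Ai 1 $$ (a,b) / (x + e 1) + Ai 2 $$ (a,b) / (x + e 2) + Ai 3 $$ (a,b) / (x + e 3)))))"
    then have ab: "a < 3" "b < 3" by auto
    have "poly (P a b) x = p x * (\<delta> a b - h * x * (Ai 1 $$ (a,b) / (x + e 1) + Ai 2 $$ (a,b) / (x + e 2) + Ai 3 $$ (a,b) / (x + e 3)))"
      unfolding clear[OF that] PC[OF ab] ..
    then show "mat 3 3 (\<lambda>(a,b). poly (P a b) x) $$ (a,b) = (p x \<cdot>\<^sub>m (1\<^sub>m 3 - mat 3 3 (\<lambda>(a,b). h * x *
      (Ai 1 $$ (a,b) / (x + e 1) + Ai 2 $$ (a,b) / (x + e 2) + Ai 3 $$ (a,b) / (x + e 3))))) $$ (a,b)"
      using ab by (simp add: \<delta>_def)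
  qed auto

  \<comment> \<open>At \<open>x = - e i\<close> every term except that of \<open>Ai i\<close>
    contains a vanishing factor. The remaining constant is nonzero because the \<open>e i\<close>
    are distinct.\<close>
  have residue: "\<exists>c. c \<noteq> 0 \<and> A (- e (Suc j)) = c \<cdot>\<^sub>m B j" if j: "j < 3" for j
  proof -
    have "\<exists>c. c \<noteq> 0 \<and> (\<forall>a<3. \<forall>b<3. poly (P a b) (- e (Suc j)) = c * B j $$ (a,b))"
      using less3[OF j]
    proof (elim disjE)
      assume "j = 0"
      then have j: "Suc j = 1" "B j = Ai 1" using B012 by simp_all
      show ?thesis unfolding j using e123 dist h0
        by (intro exI[of _ "h * (1 - e 1/e 2) * (1 - e 1/e 3)"])
           (auto simp: A_entry p_def)
    next
      assume "j = 1"
      then have j: "Suc j = 2" "B j = Ai 2" using B012 by simp_all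
      show ?thesis unfolding j using e123 dist h0
        by (intro exI[of _ "h * (1 - e 2/e 1) * (1 - e 2/e 3)"])
           (auto simp: A_entry p_def)
    next
      assume "j = 2"
      then have j: "Suc j = 3" "B j = Ai 3" using B012 by simp_all
      show ?thesis unfolding j using e123 dist h0
        by (intro exI[of _ "h * (1 - e 3/e 1) * (1 - e 3/e 2)"])
           (auto simp: A_entry p_def)
    qed
    then obtain c where c: "c \<noteq> 0" "\<forall>a<3. \<forall>b<3. poly (P a b) (- e (Suc j)) = c * B j $$ (a,b)" by auto
    have "A (- e (Suc j)) = c \<cdot>\<^sub>m B j"
      unfolding A_poly using c Bc[OF j] by (intro eq_matI) auto
    then show ?thesis using c by auto
  qed

  \<comment> \<open>The zero of \<open>det A\<close> at \<open>- e (Suc j)\<close> provides a kernel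
    vector of \<open>B j\<close>; that this zero is simple shows that the kernel is no larger than a
    line.\<close>
  have "\<exists>u. u \<in> carrier_vec 3 \<and> u \<noteq> 0\<^sub>v 3 \<and> B j *\<^sub>v u = 0\<^sub>v 3 \<and>
      (\<forall>y\<in>carrier_vec 3. B j *\<^sub>v y = 0\<^sub>v 3 \<longrightarrow> (\<exists>c. y = c \<cdot>\<^sub>v u))" if j: "j < 3" for j
  proof -
    have jI: "Suc j \<in> {1..9}" using j by simp
    obtain c where c: "c \<noteq> 0" "A (- e (Suc j)) = c \<cdot>\<^sub>m B j" using residue[OF j] by auto
    have ker: "A (- e (Suc j)) *\<^sub>v y = 0\<^sub>v 3" if "y \<in> carrier_vec 3" "B j *\<^sub>v y = 0\<^sub>v 3" for y
    proof -
      have "(c \<cdot>\<^sub>m B j) *\<^sub>v y = c \<cdot>\<^sub>v (B j *\<^sub>v y)" using Bc[OF j] that(1) by (intro eq_vecI) auto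
      then show ?thesis using c that by (auto intro!: eq_vecI)
    qed
    have "det (A (- e (Suc j))) = 0" unfolding detA' using jI by (auto intro!: prod_zero)
    then have "det (B j) = 0" using c Bc[OF j] by simp
    then obtain u where u: "u \<in> carrier_vec 3" "u \<noteq> 0\<^sub>v 3" "B j *\<^sub>v u = 0\<^sub>v 3"
      using det_0_iff_vec_prod_zero[OF Bc[OF j]] by auto
    have "\<not> [:e (Suc j), 1:]^2 dvd det (mat 3 3 (\<lambda>(a,b). P a b))"
    proof (rule linear_factor_prod_simple[OF edist _ jI])
      show "poly (det (mat 3 3 (\<lambda>(a,b). P a b))) x = \<kappa>^3 * (\<Prod>i=1..9. x + e i)" for x
        unfolding det_poly_mat[symmetric] A_poly[symmetric] by (rule detA')
    qed (use \<kappa>0 in auto)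
    then have simple: "\<not> [:- (- e (Suc j)), 1:]^2 dvd det (mat 3 3 (\<lambda>(a,b). P a b))" by simp
    have "\<exists>d. y = d \<cdot>\<^sub>v u" if y: "y \<in> carrier_vec 3" "B j *\<^sub>v y = 0\<^sub>v 3" for y
      using ker[OF u(1,3)] ker[OF y] unfolding A_poly
      by (intro simple_zero_det_kernel[OF _ simple u(1,2) _ y(1)]) auto
    then show ?thesis using u by blast
  qed
  then obtain u where u: "\<And>j. j < 3 \<Longrightarrow> u j \<in> carrier_vec 3 \<and> u j \<noteq> 0\<^sub>v 3 \<and> B j *\<^sub>v u j = 0\<^sub>v 3 \<and>
      (\<forall>y\<in>carrier_vec 3. B j *\<^sub>v y = 0\<^sub>v 3 \<longrightarrow> (\<exists>c. y = c \<cdot>\<^sub>v u j))"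
    by metis

  interpret S: scalar_residue_sum 3 3 B ql lb "(1 - s) / h" u
  proof
    fix a b :: nat assume ab: "a < 3" "b < 3"
    \<comment> \<open>Comparison of the coefficients of \<open>x^3\<close> shows that the residues
      sum to the scalar \<open>(1 - s) / h\<close>.\<close>
    have "\<kappa> * \<delta> a b = (\<delta> a b - h * (Ai 1 $$ (a,b) + Ai 2 $$ (a,b) + Ai 3 $$ (a,b))) / (e 1*e 2*e 3)"
      using PC[OF ab] by (simp add: P_def C\<^sub>3_def)
    then have "h * (Ai 1 $$ (a,b) + Ai 2 $$ (a,b) + Ai 3 $$ (a,b)) = (1 - s) * \<delta> a b"
      using e123 by (simp add: s_def field_simps)
    then have "Ai 1 $$ (a,b) + Ai 2 $$ (a,b) + Ai 3 $$ (a,b) = (1 - s) / h * \<delta> a b"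
      using h0 by (simp add: field_simps)
    then show "(\<Sum>j<3. B j $$ (a,b)) = (if a = b then (1 - s) / h else 0)"
      unfolding sum_lessThan_3 B012 by (simp add: \<delta>_def)
  next
    show "ql * ((1 - s) / h) + lb = 0" using s0 h0 by (simp add: ql_def lb_def field_simps)
  next
    fix y :: "complex vec" assume y: "y \<in> carrier_vec 3" "\<And>j. j < 3 \<Longrightarrow> B j *\<^sub>v y = 0\<^sub>v 3"
    then show "y = 0\<^sub>v 3" using kerint y(2)[of 0] y(2)[of 1] y(2)[of 2] unfolding B012 by simp
  qed (use Bc lb0 u in auto)

  let ?W = "qmc_W 3 3 B ql lb"
  \<comment> \<open>The dimension is \<open>9 - (3 + 3) = 3\<close>.\<close>
  have ex: "\<exists>v. quot_basis 9 ?W 3 v" using S.quot_basis_qmc[of 3] by simp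

  \<comment> \<open>The transformed pencil and its determinant\<close>
  define \<kappa>t where "\<kappa>t = 1 / (\<kappa> * (e 1 * e 2 * e 3)^2)"
  define et where "et = (\<lambda>i. if i \<le> 3 then e i else \<kappa> * e 1 * e 2 * e 3 * e i)"
  have second: "\<exists>At1 At2. At1 \<in> carrier_mat 3 3 \<and> At2 \<in> carrier_mat 3 3 \<and>
      (\<forall>x. x \<noteq> - e 1 \<and> x \<noteq> - e 2 \<and> x \<noteq> - e 3 \<longrightarrow>
         p x \<cdot>\<^sub>m (1\<^sub>m 3 - (h * x) \<cdot>\<^sub>m
            ((1 / (x + e 1)) \<cdot>\<^sub>m Gb 1 + (1 / (x + e 2)) \<cdot>\<^sub>m Gb 2 + (1 / (x + e 3)) \<cdot>\<^sub>m Gb 3))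
         = 1\<^sub>m 3 + x \<cdot>\<^sub>m At1 + x^2 \<cdot>\<^sub>m At2 + (\<kappa>t * x^3) \<cdot>\<^sub>m 1\<^sub>m 3) \<and>
      (\<forall>x. det (1\<^sub>m 3 + x \<cdot>\<^sub>m At1 + x^2 \<cdot>\<^sub>m At2 + (\<kappa>t * x^3) \<cdot>\<^sub>m 1\<^sub>m 3) = \<kappa>t^3 * (\<Prod>i=1..9. x + et i))"
    if v: "quot_basis 9 ?W 3 v"
      and Gb: "\<forall>i\<in>{1,2,3}. induced_mat 9 ?W 3 v (qmc_G 3 3 B ql lb (i - 1)) (Gb i)"
    for v Gb
  proof -
    note W = S.qmc_W_span[simplified]
    have v': "quot_basis 9 (family_span 9 6 S.W_basis) 3 v" using v by (simp add: W)
    let ?G = "qmc_G 3 3 B ql lb"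
    have Gc: "?G i \<in> carrier_mat 9 9" for i by (simp add: qmc_G_def)
    have ind: "induced_mat 9 (family_span 9 6 S.W_basis) 3 v (?G 0) (Gb 1)"
      "induced_mat 9 (family_span 9 6 S.W_basis) 3 v (?G 1) (Gb 2)"
      "induced_mat 9 (family_span 9 6 S.W_basis) 3 v (?G 2) (Gb 3)"
      using Gb by (auto simp: W)
    then have Gbc: "Gb 1 \<in> carrier_mat 3 3" "Gb 2 \<in> carrier_mat 3 3" "Gb 3 \<in> carrier_mat 3 3"
      by (auto simp: induced_mat_def)
    have "qmc_Gsum 3 3 B ql lb = ?G 0 + (?G 1 + ?G 2)"
      using Gc[of 2] by (simp add: qmc_Gsum_def upt_rec[of _ 3] numeral_2_eq_2)
    moreover have "induced_mat 9 (family_span 9 6 S.W_basis) 3 v (?G 0 + (?G 1 + ?G 2)) (Gb 1 + (Gb 2 + Gb 3))"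
      by (intro induced_mat_add v' ind Gc add_carrier_mat)
    ultimately have "Gb 1 + (Gb 2 + Gb 3) = lb \<cdot>\<^sub>m 1\<^sub>m 3"
      using S.induced_mat_qmc_Gsum[of 3 v] v by (simp add: W)
    then have eq: "(Gb 1 + (Gb 2 + Gb 3)) $$ (a,b) = (lb \<cdot>\<^sub>m 1\<^sub>m 3) $$ (a,b)" for a b by simp
    have Gbsum: "Gb 1 $$ (a,b) + Gb 2 $$ (a,b) + Gb 3 $$ (a,b) = lb * \<delta> a b" if "a < 3" "b < 3" for a b
      using eq[of a b] that Gbc by (simp add: \<delta>_def add.assoc)

    define At1 where "At1 = mat 3 3 (\<lambda>(a,b). C\<^sub>1 (\<delta> a b) (Gb 1 $$ (a,b)) (Gb 2 $$ (a,b)) (Gb 3 $$ (a,b)))"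
    define At2 where "At2 = mat 3 3 (\<lambda>(a,b). C\<^sub>2 (\<delta> a b) (Gb 1 $$ (a,b)) (Gb 2 $$ (a,b)) (Gb 3 $$ (a,b)))"
    define Pt where "Pt a b = [:\<delta> a b, At1 $$ (a,b), At2 $$ (a,b), \<kappa>t * \<delta> a b:]" for a b
    define At where "At x = 1\<^sub>m 3 + x \<cdot>\<^sub>m At1 + x^2 \<cdot>\<^sub>m At2 + (\<kappa>t * x^3) \<cdot>\<^sub>m 1\<^sub>m 3" for x
    have Atc: "At1 \<in> carrier_mat 3 3" "At2 \<in> carrier_mat 3 3" by (simp_all add: At1_def At2_def)
    have At_poly: "At x = mat 3 3 (\<lambda>(a,b). poly (Pt a b) x)" for x
      using Atc
      by (intro eq_matI) (auto simp: At_def Pt_def \<delta>_def algebra_simps power2_eq_square power3_eq_cube)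
    \<comment> \<open>The induced matrices sum to \<open>lb\<close>, and
      \<open>1 - h * lb = 1 / s\<close>; so the leading coefficient is
      \<open>1 / (s * e 1 * e 2 * e 3)\<close>, which is \<open>\<kappa>t\<close>.\<close>
    have lead: "C\<^sub>3 (\<delta> a b) (Gb 1 $$ (a,b)) (Gb 2 $$ (a,b)) (Gb 3 $$ (a,b)) = \<kappa>t * \<delta> a b" if "a < 3" "b < 3" for a b
    proof -
      have "1 - h * lb = 1 / s" using h0 s0 by (simp add: lb_def)
      then have "\<delta> a b - h * (lb * \<delta> a b) = \<delta> a b / s" by (metis left_diff_distrib mult.assoc mult_1 times_divide_eq_left)
      then show ?thesis unfolding C\<^sub>3_def Gbsum[OF that] \<kappa>t_def
        by (simp add: s_def power2_eq_square)
    qed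
    let ?R = "\<lambda>x. 1\<^sub>m 3 - (h * x) \<cdot>\<^sub>m
            ((1 / (x + e 1)) \<cdot>\<^sub>m Gb 1 + (1 / (x + e 2)) \<cdot>\<^sub>m Gb 2 + (1 / (x + e 3)) \<cdot>\<^sub>m Gb 3)"
    have form: "p x \<cdot>\<^sub>m ?R x = At x" if x: "x \<noteq> - e 1" "x \<noteq> - e 2" "x \<noteq> - e 3" for x
    proof (rule eq_matI)
      fix a b assume "a < dim_row (At x)" "b < dim_col (At x)"
      then have ab: "a < 3" "b < 3" by (auto simp: At_poly)
      have "(p x \<cdot>\<^sub>m ?R x) $$ (a,b)
         = p x * (\<delta> a b - h * x * (Gb 1 $$ (a,b) / (x + e 1) + Gb 2 $$ (a,b) / (x + e 2) + Gb 3 $$ (a,b) / (x + e 3)))"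
        using ab Gbc by (simp add: \<delta>_def)
      also have "\<dots> = poly (Pt a b) x"
        unfolding clear[OF x] lead[OF ab] using ab by (simp add: Pt_def At1_def At2_def)
      finally show "(p x \<cdot>\<^sub>m ?R x) $$ (a,b) = At x $$ (a,b)" using ab by (simp add: At_poly)
    qed (use Gbc in \<open>auto simp: At_poly\<close>)

    \<comment> \<open>The excluded points are the poles in \<open>x\<close> and those in
      \<open>x / s\<close>, so that every division below is legitimate.\<close>
    have det_generic: "det (At x) = \<kappa>t^3 * (\<Prod>i=1..9. x + et i)"
      if x: "x \<noteq> - e 1" "x \<noteq> - e 2" "x \<noteq> - e 3" and y: "x / s \<noteq> - e 1" "x / s \<noteq> - e 2" "x / s \<noteq> - e 3" for x
    proof -
      define \<alpha> where "\<alpha> j = h * x / (x + e (Suc j))" for j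
      have xe: "x + e 1 \<noteq> 0" "x + e 2 \<noteq> 0" "x + e 3 \<noteq> 0" using x by (auto simp: add_eq_0_iff2)
      have ye: "x/s + e 1 \<noteq> 0" "x/s + e 2 \<noteq> 0" "x/s + e 3 \<noteq> 0" using y by (auto simp: add_eq_0_iff2)
      have f: "1 - h * x / (x + c) * lb = (x/s + c) / (x + c)" if "x + c \<noteq> 0" for c
      proof -
        have hl: "h * lb = 1 - 1/s" using h0 by (simp add: lb_def)
        have "h * x / (x + c) * lb = (h * lb) * x / (x + c)" by simp
        also have "\<dots> = (x - x/s) / (x + c)" unfolding hl by (simp add: left_diff_distrib)
        finally have "1 - h * x / (x + c) * lb = (x + c) / (x + c) - (x - x/s) / (x + c)" using that by simp
        also have "\<dots> = ((x + c) - (x - x/s)) / (x + c)" by (rule diff_divide_distrib[symmetric])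
        finally show ?thesis by (simp add: add.commute)
      qed
      \<comment> \<open>Here the argument \<open>x / s\<close> appears: the weights from the matrix
        determinant lemma are the partial fraction coefficients of the original pencil at
        \<open>x / s\<close>.\<close>
      have g: "h * x / (x + c) * ql / (1 - h * x / (x + c) * lb) = h * (x/s) / (x/s + c)" if "x + c \<noteq> 0" for c
        unfolding f[OF that] using that by (simp add: ql_def)
      have \<alpha>012: "\<alpha> 0 = h * x / (x + e 1)" "\<alpha> 1 = h * x / (x + e 2)" "\<alpha> 2 = h * x / (x + e 3)"
        by (simp_all add: \<alpha>_def numeral_2_eq_2 numeral_3_eq_3)
      have nz: "1 - \<alpha> j * lb \<noteq> 0" if "j < 3" for j
      proof -
        have "1 - h * x / (x + c) * lb \<noteq> 0" if "x + c \<noteq> 0" "x/s + c \<noteq> 0" for c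
          unfolding f[OF that(1)] using that by simp
        then show ?thesis using less3[OF that] \<alpha>012 xe ye by metis
      qed
      \<comment> \<open>A sum with a negated scalar replaces the difference so that the closure
        rules for sums and multiples apply.\<close>
      let ?M = "1\<^sub>m 9 + (- (h * x)) \<cdot>\<^sub>m
          ((1 / (x + e 1)) \<cdot>\<^sub>m ?G 0 + (1 / (x + e 2)) \<cdot>\<^sub>m ?G 1 + (1 / (x + e 3)) \<cdot>\<^sub>m ?G 2)"
      have "block_resolvent 3 3 B (\<lambda>j. 1 - \<alpha> j * lb) (\<lambda>j. \<alpha> j * ql) = ?M"
      proof (rule eq_matI)
        fix r c assume "r < dim_row ?M" "c < dim_col ?M"
        then have rc: "r < 9" "c < 9" using Gc[of 2] by auto
        then have "r div 3 = 0 \<or> r div 3 = 1 \<or> r div 3 = 2" by linarith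
        then show "block_resolvent 3 3 B (\<lambda>j. 1 - \<alpha> j * lb) (\<lambda>j. \<alpha> j * ql) $$ (r,c) = ?M $$ (r,c)"
          using rc by (elim disjE) (auto simp: block_resolvent_def qmc_G_def \<alpha>012[unfolded One_nat_def] algebra_simps)
      qed (use Gc[of 2] in \<open>auto simp: block_resolvent_def\<close>)
      moreover have "induced_mat 9 (family_span 9 6 S.W_basis) 3 v ?M (1\<^sub>m 3 + (- (h * x)) \<cdot>\<^sub>m
            ((1 / (x + e 1)) \<cdot>\<^sub>m Gb 1 + (1 / (x + e 2)) \<cdot>\<^sub>m Gb 2 + (1 / (x + e 3)) \<cdot>\<^sub>m Gb 3))"
        by (intro induced_mat_add induced_mat_smult induced_mat_one v' ind Gc add_carrier_mat smult_carrier_mat one_carrier_mat)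
      moreover have "1\<^sub>m 3 + (- (h * x)) \<cdot>\<^sub>m
            ((1 / (x + e 1)) \<cdot>\<^sub>m Gb 1 + (1 / (x + e 2)) \<cdot>\<^sub>m Gb 2 + (1 / (x + e 3)) \<cdot>\<^sub>m Gb 3) = ?R x"
        using Gbc by (intro eq_matI) auto
      ultimately have "induced_mat 9 ?W 3 v (block_resolvent 3 3 B (\<lambda>j. 1 - \<alpha> j * lb) (\<lambda>j. \<alpha> j * ql)) (?R x)"
        by (simp add: W)
      then have "det (?R x) = (\<Prod>j<3. 1 - \<alpha> j * lb) ^ 2
          * det (1\<^sub>m 3 - mat 3 3 (\<lambda>(a,b). \<Sum>j<3. \<alpha> j * ql / (1 - \<alpha> j * lb) * B j $$ (a,b)))" (is "_ = _ * det ?D")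
        using S.det_induced_block_resolvent[of 3 v \<alpha> "?R x"] v nz by simp
      also have "(\<Prod>j<3. 1 - \<alpha> j * lb) = (x/s + e 1) / (x + e 1) * ((x/s + e 2) / (x + e 2)) * ((x/s + e 3) / (x + e 3))"
        by (simp only: prod_lessThan_3 \<alpha>012 f xe not_False_eq_True)
      also have "?D = 1\<^sub>m 3 - mat 3 3 (\<lambda>(a,b). h * (x/s) *
      (Ai 1 $$ (a,b) / (x/s + e 1) + Ai 2 $$ (a,b) / (x/s + e 2) + Ai 3 $$ (a,b) / (x/s + e 3)))" (is "_ = ?D'")
        by (simp only: sum_lessThan_3 \<alpha>012 g xe not_False_eq_True B012) (simp add: algebra_simps)
      finally have R: "det (?R x) = ((x/s + e 1) / (x + e 1) * ((x/s + e 2) / (x + e 2)) * ((x/s + e 3) / (x + e 3)))^2 * det ?D'" .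
      \<comment> \<open>The matrix \<open>?D'\<close> is the normalised pencil at
        \<open>x / s\<close>; the exponent 3 is its size.\<close>
      have "p (x/s)^3 * det ?D' = \<kappa>^3 * (\<Prod>i=1..9. x/s + e i)"
        using detA'[of "x/s"] unfolding A_generic[OF y] by (simp add: det_smult minus_carrier_mat)
      then have D': "det ?D' = \<kappa>^3 * (\<Prod>i=1..9. x/s + e i) / p (x/s)^3"
        using p0[OF y] by (simp add: field_simps)
      have px: "p z = (z + e 1) * (z + e 2) * (z + e 3) / (e 1 * e 2 * e 3)" for z
        using e123 by (simp add: p_def field_simps)
      have Q: "(\<Prod>i=4..9. x + et i) = s^6 * (\<Prod>i=4..9. x/s + e i)"
      proof -
        have "et i = s * e i" if "4 \<le> i" for i using that by (simp add: et_def s_def)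
        then have "(\<Prod>i=4..9. x + et i) = (\<Prod>i=4..9. s * (x/s + e i))"
          using s0 by (intro prod.cong) (auto simp: distrib_left)
        then show ?thesis by (simp add: prod.distrib)
      qed
      \<comment> \<open>This holds because \<open>\<kappa>t * s^2 = \<kappa>\<close>. The power
        \<open>s^6\<close> comes from the six points that are multiplied by
        \<open>s\<close>.\<close>
      have k: "\<kappa>t^3 * s^6 = \<kappa>^3"
        using \<kappa>0 e123 by (simp add: \<kappa>t_def s_def field_simps)
      have et123: "et 1 = e 1" "et 2 = e 2" "et 3 = e 3" by (simp_all add: et_def)
      \<comment> \<open>\<open>X\<close> and \<open>Y\<close> stand for the products of the three
        factors \<open>x + e i\<close> and \<open>x/s + e i\<close>, \<open>E\<close> for
        \<open>e 1 * e 2 * e 3\<close>, \<open>K\<close> for \<open>\<kappa>^3\<close>, and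
        \<open>Z\<close> for the product over the other six points. All powers of \<open>Y\<close>
        and \<open>E\<close> cancel and a single \<open>X\<close> survives, which is why the first
        three points do not move.\<close>
      have cancel: "(X / E)^3 * ((Y / X)^2 * (K * (Y * Z) / (Y / E)^3)) = K * X * Z"
        if "X \<noteq> 0" "Y \<noteq> 0" "E \<noteq> 0" for X Y Z E K :: complex
        using that by (simp add: power2_eq_square power3_eq_cube)
      have "det (At x) = p x^3 * det (?R x)" unfolding form[OF x, symmetric] using Gbc by (simp add: det_smult)
      also have "\<dots> = ((x + e 1) * (x + e 2) * (x + e 3) / (e 1 * e 2 * e 3))^3 *
         ((((x/s + e 1) * (x/s + e 2) * (x/s + e 3)) / ((x + e 1) * (x + e 2) * (x + e 3)))^2 *
           (\<kappa>^3 * (((x/s + e 1) * (x/s + e 2) * (x/s + e 3)) * (\<Prod>i=4..9. x/s + e i))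
             / ((x/s + e 1) * (x/s + e 2) * (x/s + e 3) / (e 1 * e 2 * e 3))^3))"
        unfolding R D' px prod_1_9 by (simp only: times_divide_times_eq)
      also have "\<dots> = \<kappa>^3 * ((x + e 1) * (x + e 2) * (x + e 3)) * (\<Prod>i=4..9. x/s + e i)"
        using xe ye e123 by (intro cancel) auto
      also have "\<dots> = \<kappa>t^3 * (\<Prod>i=1..9. x + et i)"
        unfolding prod_1_9 Q et123 k[symmetric] by (simp only: mult_ac)
      finally show ?thesis .
    qed
    \<comment> \<open>Both sides are polynomials in \<open>x\<close>, so the generic identity
      extends over the excluded points \<open>- e i\<close> and \<open>- (s * e i)\<close> with
      \<open>i\<close> from 1 to 3.\<close>
    have poly_eq: "det (mat 3 3 (\<lambda>(a,b). Pt a b)) = smult (\<kappa>t^3) (\<Prod>i=1..9. [:et i, 1:])"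
    proof (rule poly_eq_off_finite[of "{- e 1, - e 2, - e 3, - (s * e 1), - (s * e 2), - (s * e 3)}"])
      fix x assume "x \<notin> {- e 1, - e 2, - e 3, - (s * e 1), - (s * e 2), - (s * e 3)}"
      then have "det (At x) = \<kappa>t^3 * (\<Prod>i=1..9. x + et i)"
        using s0 by (intro det_generic) (auto simp: field_simps)
      then show "poly (det (mat 3 3 (\<lambda>(a,b). Pt a b))) x = poly (smult (\<kappa>t^3) (\<Prod>i=1..9. [:et i, 1:])) x"
        unfolding det_poly_mat[symmetric] At_poly by (simp add: poly_prod add.commute)
    qed simp
    have "det (At x) = \<kappa>t^3 * (\<Prod>i=1..9. x + et i)" for x
      unfolding At_poly det_poly_mat poly_eq by (simp add: poly_prod add.commute)
    then show ?thesis using Atc form unfolding At_def by blast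
  qed
  show ?thesis
    using ex second unfolding Let_def
    unfolding B_def ql_def lb_def s_def h_def p_def \<kappa>t_def et_def by blast
qed

end
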